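(* Let $\gamma>0$ and let $Q$ be a quantile function with $Q(1-s)=s^{-\gamma}\ell(s)$, $s\in(0,1)$, where $\ell$ is slowly varying at $0$. Let $(k_n)$ be a sequence of integers with $1\le k_n\le n$, $k_n\to\infty$, $k_n/n\to0$, let $p_n>0$ with $p_n\to\infty$, and put $$\alpha=\liminf_{n\to\infty}\frac{\log k_n}{p_n}.$$ If $\alpha>1$, then $$\frac1{k_n\,m_{p_n}(U_{k_n+1,n})}\sum_{i=1}^{k_n}\left(\log\frac{Q(1-U_{i,n})}{Q(1-U_{k_n+1,n})}\right)^{p_n}\longrightarrow1\quad\text{in probability.}$$ If $\alpha>2$, then $$\frac1{\sqrt{k_n}\,\sigma_{p_n}(U_{k_n+1,n})}\sum_{i=1}^{k_n}\left[\left(\log\frac{Q(1-U_{i,n})}{Q(1-U_{k_n+1,n})}\right)^{p_n}-m_{p_n}(U_{k_n+1,n})\right]\stackrel{\mathcal D}{\longrightarrow}N(0,1).$$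
   Context: $Q(s)=\inf\{x:F(x)\ge s\}$, $s\in(0,1)$, is the quantile function of a distribution function $F$. $U_1,U_2,\ldots$ are iid uniform$(0,1)$ and $U_{1,n}\le\ldots\le U_{n,n}$ are the order statistics of $U_1,\ldots,U_n$. For small $v>0$ (so that $Q(1-v)>0$) let $$Y(v)=\log\frac{Q(1-Uv)}{Q(1-v)},$$ with $U$ uniform$(0,1)$, and for $p>0$ let $m_p(v)=\mathbb E\,Y(v)^p$ and $\sigma_p^2(v)=\mathbf{Var}(Y(v)^p)$, $\sigma_p(v)=\sqrt{\sigma_p^2(v)}$. (For fixed large $p$ range these are finite for $v$ small; $m_{p}(U_{k_n+1,n})$ and $\sigma_{p}(U_{k_n+1,n})$ denote these functions evaluated at the random point $U_{k_n+1,n}$, which tends to $0$ in probability.) All quantities are considered for $n$ large. A function $\ell$ is slowly varying at $0$ if it is positive near $0$ (and measurable) and $\ell(us)/\ell(s)\to1$ as $s\downarrow0$ for each $u>0$. $\stackrel{\mathcal D}{\to}$ is convergence in distribution. *)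

theory Defs
  imports "HOL-Probability.Probability"
begin

text \<open>
  Meaningful for \<open>0 < s < 1\<close>, where the set is nonempty and bounded below whenever \<open>F\<close> is a
  distribution function; elsewhere it is an unspecified value that plays no role.
\<close>
definition quantile :: "(real \<Rightarrow> real) \<Rightarrow> real \<Rightarrow> real" where
  "quantile F s = Inf {x. F x \<ge> s}"

text \<open>\<open>l\<close> is a function on \<open>(0,1)\<close>; its values outside that interval are irrelevant.\<close>
definition slowly_varying_at_0 :: "(real \<Rightarrow> real) \<Rightarrow> bool" where
  "slowly_varying_at_0 l \<longleftrightarrow>
     l \<in> borel_measurable (restrict_space borel {0<..<1}) \<and>
     (\<forall>\<^sub>F s in at_right 0. l s > 0) \<and>
     (\<forall>u>0. ((\<lambda>s. l (u * s) / l s) \<longlongrightarrow> 1) (at_right 0))"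

abbreviation uniform01 :: "real measure" where
  "uniform01 \<equiv> uniform_measure lborel {0<..<1}"

text \<open>
  The \<open>i\<close>-th smallest of \<open>U 1 \<omega>, \<dots>, U n \<omega>\<close>, counted from \<open>1\<close>.
  Only the range \<open>1 \<le> i \<le> n\<close> is meaningful.
\<close>
definition order_stat :: "(nat \<Rightarrow> 'a \<Rightarrow> real) \<Rightarrow> nat \<Rightarrow> nat \<Rightarrow> 'a \<Rightarrow> real" where
  "order_stat U n i \<omega> = sort (map (\<lambda>j. U j \<omega>) [1..<Suc n]) ! (i - 1)"

text \<open>
  The random variable \<open>Y(v)\<close> is realised on the probability space \<open>uniform01\<close>, where \<open>U\<close> is the
  identity; it is nonnegative almost surely once \<open>Q (1 - v) > 0\<close>.
\<close>
definition Y :: "(real \<Rightarrow> real) \<Rightarrow> real \<Rightarrow> real \<Rightarrow> real" where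
  "Y Q v u = ln (Q (1 - u * v) / Q (1 - v))"

definition Y_mean :: "(real \<Rightarrow> real) \<Rightarrow> real \<Rightarrow> real \<Rightarrow> real" where
  "Y_mean Q p v = prob_space.expectation uniform01 (\<lambda>u. Y Q v u powr p)"

definition Y_var :: "(real \<Rightarrow> real) \<Rightarrow> real \<Rightarrow> real \<Rightarrow> real" where
  "Y_var Q p v = prob_space.variance uniform01 (\<lambda>u. Y Q v u powr p)"

definition Y_sd :: "(real \<Rightarrow> real) \<Rightarrow> real \<Rightarrow> real \<Rightarrow> real" where
  "Y_sd Q p v = sqrt (Y_var Q p v)"

text \<open>
  Measurability is demanded explicitly because \<open>measure M A = 0\<close> for non-measurable \<open>A\<close>.
\<close>
definition conv_in_prob :: "'a measure \<Rightarrow> (nat \<Rightarrow> 'a \<Rightarrow> real) \<Rightarrow> real \<Rightarrow> bool" where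
  "conv_in_prob M X c \<longleftrightarrow>
     (\<forall>n. X n \<in> borel_measurable M) \<and>
     (\<forall>\<epsilon>>0. (\<lambda>n. measure M {\<omega> \<in> space M. \<bar>X n \<omega> - c\<bar> > \<epsilon>}) \<longlonglongrightarrow> 0)"

definition conv_in_distr :: "'a measure \<Rightarrow> (nat \<Rightarrow> 'a \<Rightarrow> real) \<Rightarrow> real measure \<Rightarrow> bool" where
  "conv_in_distr M X N \<longleftrightarrow>
     (\<forall>n. X n \<in> borel_measurable M) \<and>
     weak_conv_m (\<lambda>n. distr M borel (X n)) N"

end

theory Submission
  imports Defs
begin

text \<open>
  Given \<open>V = U\<^bsub>k+1,n\<^esub> = v\<close>, the \<open>k\<close> smaller order statistics are distributed like an ordered sample of
  \<open>k\<close> iid variables \<open>v U\<^sub>i\<close>, so the statistic becomes a normalised sum of iid copies of \<open>Y(v)\<^sup>p\<close>.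
  In terms of characteristic functions: with \<open>\<psi>\<close> the characteristic function of one summand given
  \<open>V = v\<close>, that of the statistic is the mean of \<open>\<psi>\<^sup>k\<close> over \<open>V\<close>, and \<open>V\<close> tends to \<open>0\<close> in probability.
  Hence a bound on \<open>\<psi>\<^sup>k\<close> that is uniform over all small \<open>v\<close> suffices, and Levy's theorem applies in
  both parts, with a point mass as the limit in the first.

  By a Taylor estimate with remainder of order \<open>1 < r \<le> 2\<close> (respectively \<open>2 < r \<le> 3\<close>), such a bound
  follows once \<open>k\<^bsup>1-r\<^esup> m\<^bsub>rp\<^esub> / m\<^sub>p\<^bsup>r\<^esup>\<close> (respectively its analogue with \<open>2p\<close> and \<open>r/2\<close> in place of
  \<open>p\<close> and \<open>r\<close>) tends to \<open>0\<close>. Potter bounds sandwich \<open>Y(v)\<close> between multiples of an exponential variable,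
  so \<open>m\<^bsub>rp\<^esub> / m\<^sub>p\<^bsup>r\<^esup>\<close> is at most \<open>(r + \<epsilon>)\<^bsup>rp\<^esup>\<close> up to a constant, which \<open>k\<^bsup>1-r\<^esup>\<close> beats for \<open>r\<close> close to
  \<open>1\<close> (respectively \<open>2\<close>) exactly when \<open>\<alpha> > 1\<close> (respectively \<open>\<alpha> > 2\<close>).
\<close>

section \<open>Ranks and order statistics\<close>

text \<open>In a sorted list the entries satisfying a downward closed predicate form an initial
  segment, so a position satisfies it exactly when the segment reaches beyond that position.\<close>

lemma sorted_nth_iff:
  fixes xs :: "'b::linorder list"
  assumes "sorted xs" "i < length xs" and down: "\<And>x y. x \<le> y \<Longrightarrow> P y \<Longrightarrow> P x"
  shows "P (xs ! i) \<longleftrightarrow> i < length (filter P xs)"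
  using assms(1,2)
proof (induction xs arbitrary: i)
  case (Cons a xs)
  show ?case
  proof (cases i)
    case 0
    have "filter P xs = []" if "\<not> P a"
      using Cons.prems that down by (auto simp: filter_empty_conv)
    then show ?thesis using 0 by auto
  next
    case (Suc j)
    have "a \<le> xs ! j"
      using Cons.prems Suc by simp
    then have "P (xs ! j) \<Longrightarrow> P a"
      by (rule down)
    moreover have "filter P xs = []" if "\<not> P a"
      using Cons.prems that down by (auto simp: filter_empty_conv)
    ultimately show ?thesis using Cons.IH[of j] Cons.prems Suc by auto
  qed
qed simp

lemma length_filter_sort: "length (filter P (sort xs)) = length (filter P xs)"
  by (metis mset_filter mset_sort size_mset)

text \<open>Past the end, \<open>!\<close> recurses down to an unspecified entry of the empty list
  that depends only on the index and the length. This makes out-of-range order statistics constant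
  functions.\<close>

lemma nth_beyond_eq:
  assumes "length xs = length ys" "length xs \<le> i"
  shows "xs ! i = ys ! i"
  using assms by (induction xs ys arbitrary: i rule: list_induct2) (auto simp: nth_Cons split: nat.split)

lemma length_filter_map_upt:
  "length (filter P (map f [1..<Suc n])) = card {j\<in>{1..n}. P (f j)}"
proof -
  have "length (filter P (map f [1..<Suc n])) = length (filter (P \<circ> f) [1..<Suc n])"
    by (simp add: filter_map)
  also have "\<dots> = card (set (filter (P \<circ> f) [1..<Suc n]))"
    by (rule distinct_card[symmetric]) simp
  also have "set (filter (P \<circ> f) [1..<Suc n]) = {j\<in>{1..n}. P (f j)}"
    by auto
  finally show ?thesis .
qed

text \<open>Threshold events for order statistics become events about counts of sample points. Weak
  thresholds serve measurability, strict ones the tail bound for the order statistic of rank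
  \<open>k + 1\<close>.\<close>

lemma order_stat_iff:
  assumes "1 \<le> i" "i \<le> n" "\<And>x y. x \<le> y \<Longrightarrow> P y \<Longrightarrow> P x"
  shows "P (order_stat U n i \<omega>) \<longleftrightarrow> i \<le> card {j\<in>{1..n}. P (U j \<omega>)}"
proof -
  have "P (order_stat U n i \<omega>) \<longleftrightarrow> i - 1 < length (filter P (map (\<lambda>j. U j \<omega>) [1..<Suc n]))"
    unfolding order_stat_def
  proof (subst length_filter_sort[symmetric], rule sorted_nth_iff)
    show "i - 1 < length (sort (map (\<lambda>j. U j \<omega>) [1..<Suc n]))"
      using assms(1,2) by simp
  qed (simp, rule assms(3))
  then show ?thesis
    using assms(1) unfolding length_filter_map_upt by auto
qed

text \<open>The sublevel sets are described by a finite sum of indicators of the sample points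
  reaching a given size.\<close>

lemma measurable_order_stat:
  assumes [measurable]: "\<And>j. j \<in> {1..n} \<Longrightarrow> U j \<in> borel_measurable M"
  shows "order_stat U n i \<in> borel_measurable M"
proof -
  have *: "order_stat U n i \<in> borel_measurable M" if i: "1 \<le> i" "i \<le> n" for i
  proof (rule borel_measurableI_le)
    fix x
    have "order_stat U n i \<omega> \<le> x \<longleftrightarrow> real i \<le> (\<Sum>j\<in>{1..n}. if U j \<omega> \<le> x then 1 else 0)" for \<omega>
      using order_stat_iff[where P="\<lambda>y. y \<le> x" and U=U and \<omega>=\<omega>, OF i]
      by (simp add: sum.If_cases Int_def)
    then have "{\<omega>\<in>space M. order_stat U n i \<omega> \<le> x}
        = {\<omega>\<in>space M. real i \<le> (\<Sum>j\<in>{1..n}. if U j \<omega> \<le> x then 1 else 0)}"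
      by simp
    also have "\<dots> \<in> sets M" by measurable
    finally show "{\<omega>\<in>space M. order_stat U n i \<omega> \<le> x} \<in> sets M" .
  qed
  \<comment> \<open>Measurability is demanded of the statistics for every \<open>n\<close>,
    including those where \<open>k n + 1\<close> exceeds \<open>n\<close>; there the order statistic
    is constant. Index \<open>0\<close> acts like index \<open>1\<close> because
    \<open>i - 1\<close> is truncated.\<close>
  consider "n \<le> i - 1" | "1 \<le> i" "i \<le> n" | "i = 0" "0 < n" by linarith
  then show ?thesis
  proof cases
    case 1
    have "order_stat U n i = (\<lambda>_. sort (map (\<lambda>j. 0) [1..<Suc n]) ! (i - 1))"
      unfolding order_stat_def using 1 by (intro ext nth_beyond_eq) auto
    then show ?thesis by simp
  next
    case 2
    then show ?thesis by (rule *)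
  next
    case 3
    then have "order_stat U n i = order_stat U n 1" by (auto simp: order_stat_def)
    then show ?thesis using *[of 1] 3 by simp
  qed
qed

section \<open>Decomposition of a tie-free sample by rank patterns\<close>

abbreviation ostat :: "nat \<Rightarrow> nat \<Rightarrow> (nat \<Rightarrow> real) \<Rightarrow> real" where
  "ostat \<equiv> order_stat (\<lambda>j x. x j)"

text \<open>Here \<open>j\<close> is the index of the sample point of rank \<open>k + 1\<close> and \<open>A\<close> is the set of the \<open>k\<close>
  indices of the smaller sample points.\<close>

definition rank_pattern :: "nat \<Rightarrow> (nat \<Rightarrow> real) \<Rightarrow> nat \<Rightarrow> nat set \<Rightarrow> bool" where
  "rank_pattern n x j A \<longleftrightarrow> (\<forall>i\<in>{1..n}-{j}. if i \<in> A then x i < x j else x j < x i)"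

definition rank_patterns :: "nat \<Rightarrow> nat \<Rightarrow> (nat \<times> nat set) set" where
  "rank_patterns n k = {(j, A). j \<in> {1..n} \<and> A \<subseteq> {1..n} - {j} \<and> card A = k}"

lemma finite_rank_patterns: "finite (rank_patterns n k)"
  by (rule finite_subset[of _ "{1..n} \<times> Pow {1..n}"]) (auto simp: rank_patterns_def)

lemma mset_sorted_list_of_set: "mset (sorted_list_of_set B) = mset_set B"
  by (metis mset_sorted_list_of_multiset sorted_list_of_mset_set)

text \<open>The points below \<open>x j\<close>, then \<open>x j\<close>, then the points above it:
  with both blocks sorted, this concatenation is sorted and has the right multiset, and the first
  block has length \<open>k\<close>.\<close>

lemma sort_rank_pattern:
  assumes "(j, A) \<in> rank_patterns n k" "rank_pattern n x j A"
  shows "sort (map x [1..<Suc n]) =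
    sort (map x (sorted_list_of_set A)) @ x j # sort (map x (sorted_list_of_set ({1..n} - {j} - A)))"
proof (rule properties_for_sort)
  have A: "A \<subseteq> {1..n} - {j}" "j \<in> {1..n}" "finite A"
    using assms(1) finite_subset by (auto simp: rank_patterns_def)
  show "sorted (sort (map x (sorted_list_of_set A)) @ x j # sort (map x (sorted_list_of_set ({1..n} - {j} - A))))"
  proof -
    have lt: "x i < x j" if "i \<in> A" for i
      using assms(2) A(1) that unfolding rank_pattern_def by (metis subsetD)
    have gt: "x j < x i" if "i \<in> {1..n} - {j} - A" for i
      using assms(2) that unfolding rank_pattern_def by (metis DiffD1 DiffD2)
    have "x a \<le> x b" if "a \<in> A" "b \<in> {1..n} - {j} - A" for a b
      using lt[OF that(1)] gt[OF that(2)] by linarith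
    moreover have "x a \<le> x j" if "a \<in> A" for a using lt[OF that] by linarith
    moreover have "x j \<le> x b" if "b \<in> {1..n} - {j} - A" for b using gt[OF that] by linarith
    moreover have "finite ({1..n} - {j} - A)" by simp
    ultimately show ?thesis
      using A(3) by (simp add: sorted_append del: Diff_iff)
  qed
  have "mset (map x [1..<Suc n]) = image_mset x (mset_set {1..n})"
    by (metis atLeastLessThanSuc_atLeastAtMost mset_map mset_upt)
  also have "{1..n} = insert j (A \<union> ({1..n} - {j} - A))" using A by auto
  also have "mset_set \<dots> = add_mset j (mset_set A + mset_set ({1..n} - {j} - A))"
  proof -
    have "mset_set (A \<union> ({1..n} - {j} - A)) = mset_set A + mset_set ({1..n} - {j} - A)"
      by (rule mset_set_Union) (use A in auto)
    moreover have "j \<notin> A \<union> ({1..n} - {j} - A)" using A by auto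
    ultimately show ?thesis using A(3) by (simp del: Un_Diff_cancel)
  qed
  finally show "mset (sort (map x (sorted_list_of_set A)) @ x j # sort (map x (sorted_list_of_set ({1..n} - {j} - A))))
     = mset (map x [1..<Suc n])"
    by (simp add: mset_sorted_list_of_set del: upt_Suc)
qed

text \<open>A product over the lower order statistics is symmetric in them, so their internal order
  is irrelevant. This is why a pattern records only the set \<open>A\<close> and not a
  permutation.\<close>

lemma ostat_rank_pattern:
  assumes "(j, A) \<in> rank_patterns n k" "rank_pattern n x j A"
  shows "ostat n (k+1) x = x j"
    and "(\<Prod>i=1..k. g (ostat n i x)) = (\<Prod>i\<in>A. g (x i) :: 'c::comm_monoid_mult)"
proof -
  have A: "finite A" "card A = k"
    using assms(1) finite_subset by (auto simp: rank_patterns_def)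
  let ?L = "sort (map x (sorted_list_of_set A))"
  have len: "length ?L = k" using A by simp
  show "ostat n (k+1) x = x j"
    unfolding order_stat_def sort_rank_pattern[OF assms] using len by (simp add: nth_append)
  have "(\<Prod>i=1..k. g (ostat n i x)) = (\<Prod>i=1..k. g (?L ! (i-1)))"
    unfolding order_stat_def sort_rank_pattern[OF assms]
    using len by (intro prod.cong refl) (auto simp: nth_append)
  also have "\<dots> = (\<Prod>i<k. g (?L ! i))"
    by (rule prod.reindex_bij_witness[of _ Suc "\<lambda>i. i - 1"]) auto
  also have "\<dots> = prod_list (map g ?L)"
    using len by (simp add: prod.list_conv_set_nth lessThan_atLeast0)
  also have "\<dots> = prod_mset (mset (map g ?L))" by (rule prod_mset_prod_list[symmetric])
  also have "\<dots> = prod_mset (image_mset g (image_mset x (mset_set A)))"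
    by (simp add: mset_sorted_list_of_set)
  also have "\<dots> = (\<Prod>i\<in>A. g (x i))"
    by (simp add: prod_unfold_prod_mset multiset.map_comp comp_def)
  finally show "(\<Prod>i=1..k. g (ostat n i x)) = (\<Prod>i\<in>A. g (x i))" .
qed

text \<open>The index \<open>j\<close> is that of the sorted entry at position \<open>k\<close>
  (counted from \<open>0\<close>), and \<open>A\<close> must then consist of the indices of the
  smaller values. The patterns therefore partition the set of tie-free samples.\<close>

lemma ex1_rank_pattern:
  assumes "inj_on x {1..n}" "k < n"
  shows "\<exists>!s. s \<in> rank_patterns n k \<and> rank_pattern n x (fst s) (snd s)"
proof -
  let ?xs = "sort (map x [1..<Suc n])"
  have "?xs ! k \<in> set ?xs" using assms by (intro nth_mem) auto
  then have "?xs ! k \<in> x ` {1..n}" by auto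
  then obtain j where j: "j \<in> {1..n}" "?xs ! k = x j" by auto
  have sd: "sorted ?xs" "k < length ?xs" using assms by auto
  \<comment> \<open>More than \<open>k\<close> points are at most \<open>x j\<close> and at most
    \<open>k\<close> points are strictly below it. Without ties the two counts differ by exactly
    one, so the second one is \<open>k\<close>.\<close>
  have 1: "k < card {i\<in>{1..n}. x i \<le> x j}"
    using sorted_nth_iff[OF sd, where P="\<lambda>y. y \<le> x j"] j
    unfolding length_filter_sort length_filter_map_upt by auto
  have 2: "\<not> k < card {i\<in>{1..n}. x i < x j}"
    using sorted_nth_iff[OF sd, where P="\<lambda>y. y < x j"] j
    unfolding length_filter_sort length_filter_map_upt by auto
  let ?A = "{i\<in>{1..n}. x i < x j}"
  have 3: "{i\<in>{1..n}. x i \<le> x j} = insert j ?A"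
  proof -
    have "x i \<le> x j \<longleftrightarrow> i = j \<or> x i < x j" if "i \<in> {1..n}" for i
      using j(1) assms(1) that by (metis inj_onD le_less)
    then show ?thesis using j(1) by auto
  qed
  have "card {i\<in>{1..n}. x i \<le> x j} = Suc (card ?A)"
    unfolding 3 by (rule card_insert_disjoint) auto
  with 1 2 have "card ?A = k" by simp
  then have "(j, ?A) \<in> rank_patterns n k" using j by (auto simp: rank_patterns_def)
  moreover have "rank_pattern n x j ?A"
    unfolding rank_pattern_def
  proof
    fix i assume i: "i \<in> {1..n} - {j}"
    then have "x i \<noteq> x j" using j(1) assms(1) by (metis DiffD1 DiffD2 inj_onD singletonI)
    then show "if i \<in> ?A then x i < x j else x j < x i" using i by auto
  qed
  moreover have "s = s'" if s: "s \<in> rank_patterns n k" "rank_pattern n x (fst s) (snd s)"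
      "s' \<in> rank_patterns n k" "rank_pattern n x (fst s') (snd s')" for s s'
  proof -
    obtain j A j' A' where e: "s = (j, A)" "s' = (j', A')" by (cases s, cases s')
    have "x j = x j'"
      using ostat_rank_pattern(1)[of j A n k x] ostat_rank_pattern(1)[of j' A' n k x] s e by auto
    moreover have "j \<in> {1..n}" "j' \<in> {1..n}" using s(1,3) e by (auto simp: rank_patterns_def)
    ultimately have jj: "j = j'" using assms(1) by (simp only: inj_onD)
    have "A = {i\<in>{1..n}. x i < x j}" "A' = {i\<in>{1..n}. x i < x j'}"
    proof -
      have "B = {i\<in>{1..n}. x i < x j}" if "(j, B) \<in> rank_patterns n k" "rank_pattern n x j B" for j B
      proof (intro set_eqI iffI)
        fix i assume "i \<in> B" then show "i \<in> {i\<in>{1..n}. x i < x j}"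
          using that unfolding rank_pattern_def rank_patterns_def by auto (metis Diff_iff subsetD)+
      next
        fix i assume i: "i \<in> {i\<in>{1..n}. x i < x j}"
        then have "i \<in> {1..n} - {j}" by auto
        then have "if i \<in> B then x i < x j else x j < x i"
          using that(2) unfolding rank_pattern_def by blast
        then show "i \<in> B" using i by (auto split: if_splits)
      qed
      then show "A = {i\<in>{1..n}. x i < x j}" "A' = {i\<in>{1..n}. x i < x j'}"
        using s e by auto
    qed
    with jj e show ?thesis by simp
  qed
  ultimately show ?thesis by (intro ex1I[of _ "(j, ?A)"]) auto
qed

section \<open>Uniform samples\<close>

lemma uniform01_eq_density: "uniform01 = density lborel (\<lambda>x. ennreal (indicator {0<..<1} x))"
  unfolding uniform_measure_def
  by (intro density_cong) (auto simp: indicator_def)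

lemma prob_space_uniform01: "prob_space uniform01"
  by (rule prob_space_uniform_measure) auto

lemma AE_uniform01: "AE u in uniform01. 0 < u \<and> u < 1"
  by (rule AE_uniform_measureI) auto

lemma AE_uniform01_neq: "AE u in uniform01. u \<noteq> v"
proof -
  have "AE u in lborel. u \<noteq> v" by (rule AE_lborel_singleton)
  then show ?thesis
    unfolding uniform01_eq_density by (subst AE_density) (auto elim: eventually_mono)
qed

lemma integral_uniform01:
  fixes f :: "real \<Rightarrow> 'b::{banach, second_countable_topology}"
  assumes "f \<in> borel_measurable borel"
  shows "integral\<^sup>L uniform01 f = (\<integral>x. indicator {0<..<1} x *\<^sub>R f x \<partial>lborel)"
  unfolding uniform01_eq_density using assms by (subst integral_density) auto

text \<open>Substitution by the factor \<open>v\<close>: a uniform variable conditioned to lie below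
  \<open>v\<close> is distributed like \<open>v\<close> times a uniform variable, and the factor
  \<open>v\<close> is the probability of the condition.\<close>

lemma integral_uniform01_scale:
  fixes f :: "real \<Rightarrow> 'b::{banach, second_countable_topology}"
  assumes [measurable]: "f \<in> borel_measurable borel" and v: "0 < v" "v < 1"
  shows "(\<integral>u. (if u < v then f u else 0) \<partial>uniform01) = v *\<^sub>R (\<integral>u. f (u * v) \<partial>uniform01)"
proof -
  have "(\<integral>u. (if u < v then f u else 0) \<partial>uniform01)
      = (\<integral>u. indicator {0<..<1} u *\<^sub>R (if u < v then f u else 0) \<partial>lborel)"
    by (rule integral_uniform01) measurable
  also have "\<dots> = \<bar>v\<bar> *\<^sub>R (\<integral>u. indicator {0<..<1} (0 + v * u) *\<^sub>R
      (if 0 + v * u < v then f (0 + v * u) else 0) \<partial>lborel)"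
    using v by (intro lborel_integral_real_affine) auto
  also have "(\<integral>u. indicator {0<..<1} (0 + v * u) *\<^sub>R (if 0 + v * u < v then f (0 + v * u) else 0) \<partial>lborel)
      = (\<integral>u. indicator {0<..<1} u *\<^sub>R f (u * v) \<partial>lborel)"
  proof (rule Bochner_Integration.integral_cong[OF refl])
    fix u
    have "v * u < 1" if "u < 1" "0 < u" using v that mult_strict_mono[of v 1 u 1] by simp
    moreover have "0 < v * u \<longleftrightarrow> 0 < u" "v * u < v \<longleftrightarrow> u < 1"
      using v by (auto simp: zero_less_mult_iff)
    ultimately show "indicator {0<..<1} (0 + v * u) *\<^sub>R (if 0 + v * u < v then f (0 + v * u) else 0)
        = indicator {0<..<1} u *\<^sub>R f (u * v)"
      by (auto simp: indicator_def mult.commute)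
  qed
  also have "\<dots> = (\<integral>u. f (u * v) \<partial>uniform01)"
    by (rule integral_uniform01[symmetric]) measurable
  finally show ?thesis using v by simp
qed

lemma measure_uniform01_greaterThan:
  assumes "0 < v" "v < 1"
  shows "measure uniform01 {v<..} = 1 - v"
proof -
  have "{0<..<1} \<inter> {v<..} = {v<..<1}" using assms by auto
  then show ?thesis using assms by (subst measure_uniform_measure) auto
qed

lemma measure_uniform01_lessThan:
  assumes "0 < v" "v < 1"
  shows "measure uniform01 {..<v} = v"
proof -
  have "{0<..<1} \<inter> {..<v} = {0<..<v}" using assms by auto
  then show ?thesis using assms by (subst measure_uniform_measure) auto
qed

section \<open>Product measures of uniform variables: extracting a coordinate, absence of
  ties\<close>

abbreviation unif_cube :: "nat \<Rightarrow> (nat \<Rightarrow> real) measure" where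
  "unif_cube n \<equiv> PiM {1..n} (\<lambda>_. uniform01)"

lemma prob_space_unif_PiM: "prob_space (PiM I (\<lambda>_. uniform01))"
  by (intro prob_space_PiM prob_space_uniform01)

lemma measurable_unif_component:
  "i \<in> I \<Longrightarrow> (\<lambda>x. x i) \<in> borel_measurable (PiM I (\<lambda>_. uniform01))"
  using measurable_component_singleton[of i I "\<lambda>_. uniform01"] by simp

text \<open>The product measure is the image, under updating at \<open>j\<close>, of the product of
  one factor with the remaining ones; Fubini applies because a bounded function is integrable for a
  probability measure.\<close>

lemma integral_PiM_extract:
  fixes f :: "('i \<Rightarrow> real) \<Rightarrow> 'b::{banach, second_countable_topology}"
  assumes j: "j \<in> I" and f: "f \<in> borel_measurable (PiM I (\<lambda>_. uniform01))"
    and B: "\<And>x. norm (f x) \<le> B"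
  shows "integral\<^sup>L (PiM I (\<lambda>_. uniform01)) f
    = (\<integral>y. (\<integral>x. f (x(j := y)) \<partial>PiM (I - {j}) (\<lambda>_. uniform01)) \<partial>uniform01)"
proof -
  let ?J = "PiM (I - {j}) (\<lambda>_. uniform01)"
  let ?D = "uniform01 \<Otimes>\<^sub>M ?J"
  interpret u: prob_space uniform01 by (rule prob_space_uniform01)
  interpret J: prob_space ?J by (rule prob_space_unif_PiM)
  interpret pair_prob_space uniform01 ?J ..
  have I: "insert j (I - {j}) = I" using j by auto
  have m: "(\<lambda>(y, x). x(j := y)) \<in> ?D \<rightarrow>\<^sub>M PiM I (\<lambda>_. uniform01)"
    unfolding case_prod_beta
  proof (rule measurable_fun_upd[where J="I - {j}"])
    show "I = I - {j} \<union> {j}" using j by auto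
  qed (rule measurable_snd measurable_fst)+
  have eq: "distr ?D (PiM I (\<lambda>_. uniform01)) (\<lambda>(y, x). x(j := y)) = PiM I (\<lambda>_. uniform01)"
    using distr_pair_PiM_eq_PiM[of "I - {j}" "\<lambda>_. uniform01" j] prob_space_uniform01 unfolding I by simp
  have m2: "(\<lambda>(y, x). f (x(j := y))) \<in> borel_measurable ?D"
    using measurable_compose[OF m f] by (simp add: case_prod_beta)
  have "integral\<^sup>L (PiM I (\<lambda>_. uniform01)) f = (\<integral>z. f ((\<lambda>(y, x). x(j := y)) z) \<partial>?D)"
    by (subst eq[symmetric], rule integral_distr[OF m f])
  also have "\<dots> = (\<integral>z. (\<lambda>(y, x). f (x(j := y))) z \<partial>?D)" by (simp add: case_prod_beta)
  also have "\<dots> = (\<integral>y. (\<integral>x. f (x(j := y)) \<partial>?J) \<partial>uniform01)"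
    by (rule integral_fst[symmetric])
       (intro integrable_const_bound[where B=B] m2 AE_I2, auto simp: B)
  finally show ?thesis .
qed

text \<open>For each pair of indices, integrate the indicator of a tie by fixing coordinate
  \<open>i\<close> at \<open>y\<close>: coordinate \<open>j\<close> hits \<open>y\<close> with
  probability zero, as the uniform law has no atoms. There are finitely many pairs.\<close>

lemma AE_unif_cube_inj: "AE x in unif_cube n. inj_on x {1..n}"
proof -
  have "AE x in unif_cube n. x i \<noteq> x j" if ij: "i \<in> {1..n}" "j \<in> {1..n}" "i \<noteq> j" for i j
  proof -
    interpret prob_space "unif_cube n" by (rule prob_space_unif_PiM)
    interpret J: prob_space "PiM ({1..n} - {i}) (\<lambda>_. uniform01)" by (rule prob_space_unif_PiM)
    have [measurable]: "(\<lambda>x. x i) \<in> borel_measurable (unif_cube n)"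
        "(\<lambda>x. x j) \<in> borel_measurable (unif_cube n)"
      using ij by (auto intro: measurable_unif_component)
    let ?f = "\<lambda>x. if x i = x j then 1 else 0 :: real"
    have "integral\<^sup>L (unif_cube n) ?f
      = (\<integral>y. (\<integral>x. ?f (x(i := y)) \<partial>PiM ({1..n} - {i}) (\<lambda>_. uniform01)) \<partial>uniform01)"
    proof (rule integral_PiM_extract[where B=1])
      show "?f \<in> borel_measurable (unif_cube n)" by measurable
    qed (use ij in auto)
    also have "\<dots> = (\<integral>y. 0 \<partial>uniform01)"
    proof (rule Bochner_Integration.integral_cong[OF refl])
      fix y
      have "AE x in PiM ({1..n} - {i}) (\<lambda>_. uniform01). x j \<noteq> y"
        by (rule AE_PiM_component[OF prob_space_uniform01 _ AE_uniform01_neq]) (use ij in auto)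
      then have "(\<integral>x. ?f (x(i := y)) \<partial>PiM ({1..n} - {i}) (\<lambda>_. uniform01))
          = (\<integral>x. 0 \<partial>PiM ({1..n} - {i}) (\<lambda>_. uniform01))"
      proof (intro integral_cong_AE)
        have [measurable]: "(\<lambda>x. x j) \<in> borel_measurable (PiM ({1..n} - {i}) (\<lambda>_. uniform01))"
          by (rule measurable_unif_component) (use ij in auto)
        show "(\<lambda>x. ?f (x(i := y))) \<in> borel_measurable (PiM ({1..n} - {i}) (\<lambda>_. uniform01))"
          using ij by simp
      qed (use ij in \<open>auto elim!: eventually_mono\<close>)
      then show "(\<integral>x. ?f (x(i := y)) \<partial>PiM ({1..n} - {i}) (\<lambda>_. uniform01)) = 0" by simp
    qed
    finally have "integral\<^sup>L (unif_cube n) ?f = 0" by simp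
    then have "AE x in unif_cube n. ?f x = 0"
      by (subst (asm) integral_nonneg_eq_0_iff_AE)
        (simp_all del: One_nat_def add: integrable_const_bound[where B=1])
    then show ?thesis by (auto elim!: eventually_mono split: if_splits)
  qed
  then have "AE x in unif_cube n. \<forall>i\<in>{1..n}. \<forall>j\<in>{1..n}. i \<noteq> j \<longrightarrow> x i \<noteq> x j"
    by (intro AE_finite_allI finite_atLeastAtMost) (auto simp: AE_impI)
  then show ?thesis by (rule eventually_mono) (auto simp: inj_on_def)
qed

lemma measurable_ostat_unif: "ostat n i \<in> borel_measurable (unif_cube n)"
  by (rule measurable_order_stat) (rule measurable_unif_component)

section \<open>Conditioning on the order statistic of rank k + 1\<close>

text \<open>For \<open>k < n\<close> this is the density of the order statistic of rank
  \<open>k + 1\<close>, a beta density, without its normalising constant. That constant is the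
  number of rank patterns.\<close>

definition rank_density :: "nat \<Rightarrow> nat \<Rightarrow> real \<Rightarrow> real" where
  "rank_density n k v = v ^ k * (1 - v) ^ (n - 1 - k)"

lemma measurable_rank_density [measurable]: "rank_density n k \<in> borel_measurable borel"
  unfolding rank_density_def[abs_def] by measurable

lemma rank_density_bounds: "0 < v \<Longrightarrow> v < 1 \<Longrightarrow> 0 \<le> rank_density n k v \<and> rank_density n k v \<le> 1"
  unfolding rank_density_def by (auto intro!: mult_le_one power_le_one)

lemma rank_pattern_measurable:
  assumes "j \<in> {1..n}" "A \<subseteq> {1..n} - {j}"
  shows "Measurable.pred (unif_cube n) (\<lambda>x. rank_pattern n x j A)"
proof -
  have m: "(\<lambda>x. x i) \<in> borel_measurable (unif_cube n)" if "i \<in> {1..n}" for i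
    using that by (rule measurable_unif_component)
  have "Measurable.pred (unif_cube n) (\<lambda>x. if i \<in> A then x i < x j else x j < x i)"
    if "i \<in> {1..n} - {j}" for i
    using m[of i] m[OF assms(1)] that by (cases "i \<in> A") (simp_all del: One_nat_def)
  then show ?thesis
    unfolding rank_pattern_def by (intro pred_intros_countable_bounded) auto
qed

text \<open>Fubini over the coordinate \<open>j\<close>: given its value \<open>v\<close>, the other coordinates are independent,
  those in \<open>A\<close> lie below \<open>v\<close> and the remaining ones above.\<close>

lemma integral_rank_pattern:
  fixes g :: "real \<Rightarrow> real \<Rightarrow> complex" and q :: "real \<Rightarrow> complex"
  assumes s: "(j, A) \<in> rank_patterns n k"
    and g[measurable]: "(\<lambda>z. g (fst z) (snd z)) \<in> borel_measurable (borel \<Otimes>\<^sub>M borel)"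
    and g1: "\<And>u v. cmod (g u v) \<le> 1"
    and q[measurable]: "q \<in> borel_measurable borel" and qB: "\<And>v. cmod (q v) \<le> B"
  shows "(\<integral>x. (if rank_pattern n x j A then q (x j) * (\<Prod>i\<in>A. g (x i) (x j)) else 0) \<partial>unif_cube n)
    = (\<integral>v. q v * (\<integral>u. g (u * v) v \<partial>uniform01) ^ k * rank_density n k v \<partial>uniform01)"
proof -
  interpret u: prob_space uniform01 by (rule prob_space_uniform01)
  interpret ps: product_prob_space "\<lambda>_. uniform01" "{1..n}" ..
  have j: "j \<in> {1..n}" and A: "A \<subseteq> {1..n} - {j}" "finite A" "card A = k"
    using s finite_subset by (auto simp: rank_patterns_def)
  \<comment> \<open>The order constraint on coordinate \<open>i\<close> and its factor of the
    product are merged into one function of that coordinate and \<open>v\<close>, so that the whole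
    integrand factorises over the coordinates.\<close>
  define w where "w i a v = (if i \<in> A then if a < v then g a v else 0 else if v < a then 1 else 0)"
    for i :: nat and a v :: real
  have w1: "cmod (w i a v) \<le> 1" for i a v using g1 by (auto simp: w_def)
  have wm: "(\<lambda>z. w i (fst z) (snd z)) \<in> borel_measurable (borel \<Otimes>\<^sub>M borel)" for i
    unfolding w_def by (cases "i \<in> A") simp_all
  have wm1: "(\<lambda>a. w i a v) \<in> borel_measurable borel" for i v
    using measurable_compose[OF _ wm, of "\<lambda>a. (a, v)" borel i] by simp
  let ?F = "\<lambda>x. q (x j) * (\<Prod>i\<in>{1..n} - {j}. w i (x i) (x j))"
  have eq: "(if rank_pattern n x j A then q (x j) * (\<Prod>i\<in>A. g (x i) (x j)) else 0) = ?F x" for x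
  proof (cases "rank_pattern n x j A")
    case True
    have "(\<Prod>i\<in>{1..n} - {j}. w i (x i) (x j)) = (\<Prod>i\<in>{1..n} - {j}. if i \<in> A then g (x i) (x j) else 1)"
      using True by (intro prod.cong refl) (auto simp: w_def rank_pattern_def)
    also have "\<dots> = (\<Prod>i\<in>A. g (x i) (x j))"
      using A(1) by (subst prod.inter_restrict[symmetric]) (auto simp: Int_absorb1)
    finally show ?thesis using True by simp
  next
    case False
    then obtain i where "i \<in> {1..n} - {j}" "\<not> (if i \<in> A then x i < x j else x j < x i)"
      unfolding rank_pattern_def by blast
    then have "i \<in> {1..n} - {j}" "w i (x i) (x j) = 0"
      by (auto simp: w_def split: if_splits)
    then have "(\<Prod>i\<in>{1..n} - {j}. w i (x i) (x j)) = 0"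
      by (intro prod_zero) auto
    then show ?thesis using False by simp
  qed
  have Fm: "?F \<in> borel_measurable (unif_cube n)"
  proof (intro borel_measurable_times borel_measurable_prod)
    show "(\<lambda>x. q (x j)) \<in> borel_measurable (unif_cube n)"
      by (rule measurable_compose[OF measurable_unif_component q]) (rule j)
    fix i assume i: "i \<in> {1..n} - {j}"
    have "(\<lambda>x. (x i, x j)) \<in> unif_cube n \<rightarrow>\<^sub>M borel \<Otimes>\<^sub>M borel"
      by (intro measurable_Pair measurable_unif_component) (use i j in auto)
    from measurable_compose[OF this wm]
    show "(\<lambda>x. w i (x i) (x j)) \<in> borel_measurable (unif_cube n)" by simp
  qed
  have FB: "cmod (?F x) \<le> B" for x
  proof -
    have "cmod (\<Prod>i\<in>{1..n} - {j}. w i (x i) (x j)) \<le> 1"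
      unfolding prod_norm[symmetric] by (intro prod_le_1) (auto simp: w1)
    then show ?thesis
      using qB[of "x j"] mult_mono[of "cmod (q (x j))" B "cmod (\<Prod>i\<in>{1..n} - {j}. w i (x i) (x j))" 1]
        order_trans[OF norm_ge_zero qB]
      by (simp add: norm_mult)
  qed
  have "(\<integral>x. (if rank_pattern n x j A then q (x j) * (\<Prod>i\<in>A. g (x i) (x j)) else 0) \<partial>unif_cube n)
      = integral\<^sup>L (unif_cube n) ?F"
    unfolding eq ..
  also have "\<dots> = (\<integral>v. (\<integral>x. ?F (x(j := v)) \<partial>PiM ({1..n} - {j}) (\<lambda>_. uniform01)) \<partial>uniform01)"
    by (rule integral_PiM_extract[OF j Fm FB])
  also have "\<dots> = (\<integral>v. q v * (\<Prod>i\<in>{1..n} - {j}. \<integral>a. w i a v \<partial>uniform01) \<partial>uniform01)"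
  proof (rule Bochner_Integration.integral_cong[OF refl])
    fix v
    have "?F (x(j := v)) = q v * (\<Prod>i\<in>{1..n} - {j}. w i (x i) v)" for x
      by (auto intro!: arg_cong2[where f="(*)"] prod.cong)
    then have "(\<integral>x. ?F (x(j := v)) \<partial>PiM ({1..n} - {j}) (\<lambda>_. uniform01))
        = q v * (\<integral>x. (\<Prod>i\<in>{1..n} - {j}. w i (x i) v) \<partial>PiM ({1..n} - {j}) (\<lambda>_. uniform01))"
      by simp
    also have "(\<integral>x. (\<Prod>i\<in>{1..n} - {j}. w i (x i) v) \<partial>PiM ({1..n} - {j}) (\<lambda>_. uniform01))
        = (\<Prod>i\<in>{1..n} - {j}. \<integral>a. w i a v \<partial>uniform01)"
      using wm1 w1 by (intro ps.product_integral_prod u.integrable_const_bound[where B=1]) auto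
    finally show "(\<integral>x. ?F (x(j := v)) \<partial>PiM ({1..n} - {j}) (\<lambda>_. uniform01))
        = q v * (\<Prod>i\<in>{1..n} - {j}. \<integral>a. w i a v \<partial>uniform01)" .
  qed
  also have "\<dots> = (\<integral>v. q v * (\<integral>u. g (u * v) v \<partial>uniform01) ^ k * rank_density n k v \<partial>uniform01)"
  proof (rule integral_cong_AE)
    have "(\<lambda>z. w i (snd z) (fst z)) \<in> borel_measurable (uniform01 \<Otimes>\<^sub>M uniform01)" for i
      using measurable_compose[OF _ wm, of "\<lambda>z. (snd z, fst z)" "uniform01 \<Otimes>\<^sub>M uniform01" i] by simp
    then have "(\<lambda>v. \<integral>a. w i a v \<partial>uniform01) \<in> borel_measurable uniform01" for i
      by (intro u.borel_measurable_lebesgue_integral) (simp add: case_prod_beta')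
    then show "(\<lambda>v. q v * (\<Prod>i\<in>{1..n} - {j}. \<integral>a. w i a v \<partial>uniform01)) \<in> borel_measurable uniform01"
      by (intro borel_measurable_times borel_measurable_prod) auto
    have "(\<lambda>z. g (snd z * fst z) (fst z)) \<in> borel_measurable (uniform01 \<Otimes>\<^sub>M uniform01)"
      using measurable_compose[OF _ g, of "\<lambda>z. (snd z * fst z, fst z)" "uniform01 \<Otimes>\<^sub>M uniform01"] by simp
    then have "(\<lambda>v. \<integral>u. g (u * v) v \<partial>uniform01) \<in> borel_measurable uniform01"
      by (intro u.borel_measurable_lebesgue_integral) (simp add: case_prod_beta')
    then show "(\<lambda>v. q v * (\<integral>u. g (u * v) v \<partial>uniform01) ^ k * rank_density n k v) \<in> borel_measurable uniform01"
      by (intro borel_measurable_times borel_measurable_power borel_measurable_of_real) auto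
    show "AE v in uniform01. q v * (\<Prod>i\<in>{1..n} - {j}. \<integral>a. w i a v \<partial>uniform01)
        = q v * (\<integral>u. g (u * v) v \<partial>uniform01) ^ k * rank_density n k v"
      using AE_uniform01
    proof (rule eventually_mono)
      fix v :: real assume v: "0 < v \<and> v < 1"
      have gm: "(\<lambda>u. g u v) \<in> borel_measurable borel"
        using measurable_compose[OF _ g, of "\<lambda>u. (u, v)" borel] by simp
      \<comment> \<open>Each coordinate in \<open>A\<close> contributes \<open>v\<close> times the
        mean of \<open>g\<close> at a rescaled uniform point, each of the other
        \<open>n - 1 - k\<close> contributes \<open>1 - v\<close>. The powers of \<open>v\<close>
        and \<open>1 - v\<close> together form \<open>rank_density\<close>.\<close>
      have 1: "(\<integral>a. w i a v \<partial>uniform01) = v * (\<integral>u. g (u * v) v \<partial>uniform01)" if "i \<in> A" for i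
        using integral_uniform01_scale[OF gm, of v] v that by (simp add: w_def scaleR_conv_of_real)
      have 2: "(\<integral>a. w i a v \<partial>uniform01) = 1 - v" if "i \<notin> A" for i
      proof -
        have "(\<integral>a. w i a v \<partial>uniform01) = (\<integral>a. complex_of_real (indicator {v<..} a) \<partial>uniform01)"
          using that by (intro Bochner_Integration.integral_cong) (auto simp: w_def indicator_def)
        also have "\<dots> = of_real (measure uniform01 {v<..})"
          by (simp add: Int_absorb2)
        finally show ?thesis using measure_uniform01_greaterThan v by simp
      qed
      have "(\<Prod>i\<in>{1..n} - {j}. \<integral>a. w i a v \<partial>uniform01)
        = (\<Prod>i\<in>A. \<integral>a. w i a v \<partial>uniform01) * (\<Prod>i\<in>{1..n} - {j} - A. \<integral>a. w i a v \<partial>uniform01)"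
        by (subst prod.subset_diff[OF A(1)]) (auto simp: mult.commute)
      also have "\<dots> = (v * (\<integral>u. g (u * v) v \<partial>uniform01)) ^ k * (1 - v) ^ card ({1..n} - {j} - A)"
        using 1 2 A by simp
      also have "card ({1..n} - {j} - A) = n - 1 - k"
        using A j by (simp add: card_Diff_subset)
      finally show "q v * (\<Prod>i\<in>{1..n} - {j}. \<integral>a. w i a v \<partial>uniform01)
        = q v * (\<integral>u. g (u * v) v \<partial>uniform01) ^ k * rank_density n k v"
        by (simp add: rank_density_def power_mult_distrib)
    qed
  qed
  finally show ?thesis .
qed

lemma measurable_prod_ostat:
  fixes g :: "real \<Rightarrow> real \<Rightarrow> complex"
  assumes g[measurable]: "(\<lambda>z. g (fst z) (snd z)) \<in> borel_measurable (borel \<Otimes>\<^sub>M borel)"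
  shows "(\<lambda>x. \<Prod>i=1..k. g (ostat n i x) (ostat n (k+1) x)) \<in> borel_measurable (unif_cube n)"
proof (rule borel_measurable_prod)
  fix i
  have "(\<lambda>x. (ostat n i x, ostat n (k+1) x)) \<in> unif_cube n \<rightarrow>\<^sub>M borel \<Otimes>\<^sub>M borel"
    by (intro measurable_Pair measurable_ostat_unif)
  from measurable_compose[OF this g]
  show "(\<lambda>x. g (ostat n i x) (ostat n (k+1) x)) \<in> borel_measurable (unif_cube n)" by simp
qed

text \<open>Almost every sample has exactly one rank pattern, so the integrand is a sum over
  patterns with a single nonzero summand at most. All patterns contribute the same integral, whence
  the cardinality. This expresses that, given the order statistic of rank \<open>k + 1\<close>, the
  lower ones act as an iid sample; \<open>q\<close> carries a function of the conditioning
  value.\<close>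

lemma integral_ostat:
  fixes g :: "real \<Rightarrow> real \<Rightarrow> complex" and q :: "real \<Rightarrow> complex"
  assumes kn: "k < n"
    and g[measurable]: "(\<lambda>z. g (fst z) (snd z)) \<in> borel_measurable (borel \<Otimes>\<^sub>M borel)"
    and g1: "\<And>u v. cmod (g u v) \<le> 1"
    and q[measurable]: "q \<in> borel_measurable borel" and qB: "\<And>v. cmod (q v) \<le> B"
  shows "(\<integral>x. q (ostat n (k+1) x) * (\<Prod>i=1..k. g (ostat n i x) (ostat n (k+1) x)) \<partial>unif_cube n)
    = card (rank_patterns n k) *
      (\<integral>v. q v * (\<integral>u. g (u * v) v \<partial>uniform01) ^ k * rank_density n k v \<partial>uniform01)"
proof -
  interpret P: prob_space "unif_cube n" by (rule prob_space_unif_PiM)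
  let ?T = "\<lambda>s x. if rank_pattern n x (fst s) (snd s)
     then q (x (fst s)) * (\<Prod>i\<in>snd s. g (x i) (x (fst s))) else 0"
  have Tm: "?T s \<in> borel_measurable (unif_cube n)" if "s \<in> rank_patterns n k" for s
  proof -
    have s: "fst s \<in> {1..n}" "snd s \<subseteq> {1..n} - {fst s}"
      using that by (auto simp: rank_patterns_def)
    have "(\<lambda>x. (x i, x (fst s))) \<in> unif_cube n \<rightarrow>\<^sub>M borel \<Otimes>\<^sub>M borel" if "i \<in> snd s" for i
      by (intro measurable_Pair measurable_unif_component) (use s that in auto)
    from measurable_compose[OF this g]
    have "(\<lambda>x. g (x i) (x (fst s))) \<in> borel_measurable (unif_cube n)" if "i \<in> snd s" for i
      using that by simp
    then show ?thesis
      by (intro measurable_If borel_measurable_times borel_measurable_prod borel_measurable_const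
          measurable_compose[OF measurable_unif_component q] rank_pattern_measurable[unfolded pred_def] s) auto
  qed
  have TB: "cmod (?T s x) \<le> B" for s x
  proof -
    have "cmod (\<Prod>i\<in>snd s. g (x i) (x (fst s))) \<le> 1"
      unfolding prod_norm[symmetric] by (intro prod_le_1) (auto simp: g1)
    then show ?thesis
      using qB[of "x (fst s)"] order_trans[OF norm_ge_zero qB]
        mult_mono[of "cmod (q (x (fst s)))" B "cmod (\<Prod>i\<in>snd s. g (x i) (x (fst s)))" 1]
      by (simp add: norm_mult)
  qed
  have "(\<integral>x. q (ostat n (k+1) x) * (\<Prod>i=1..k. g (ostat n i x) (ostat n (k+1) x)) \<partial>unif_cube n)
      = (\<integral>x. (\<Sum>s\<in>rank_patterns n k. ?T s x) \<partial>unif_cube n)"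
  proof (rule integral_cong_AE)
    show "(\<lambda>x. q (ostat n (k+1) x) * (\<Prod>i=1..k. g (ostat n i x) (ostat n (k+1) x))) \<in> borel_measurable (unif_cube n)"
      by (intro borel_measurable_times measurable_prod_ostat g measurable_compose[OF measurable_ostat_unif q])
    show "(\<lambda>x. \<Sum>s\<in>rank_patterns n k. ?T s x) \<in> borel_measurable (unif_cube n)"
      by (rule borel_measurable_sum) (rule Tm)
    show "AE x in unif_cube n. q (ostat n (k+1) x) * (\<Prod>i=1..k. g (ostat n i x) (ostat n (k+1) x))
        = (\<Sum>s\<in>rank_patterns n k. ?T s x)"
      using AE_unif_cube_inj
    proof (rule eventually_mono)
      fix x :: "nat \<Rightarrow> real" assume x: "inj_on x {1..n}"
      obtain s where s: "s \<in> rank_patterns n k" "rank_pattern n x (fst s) (snd s)"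
        and uniq: "\<And>s'. s' \<in> rank_patterns n k \<Longrightarrow> rank_pattern n x (fst s') (snd s') \<Longrightarrow> s' = s"
        using ex1E[OF ex1_rank_pattern[OF x kn]] by metis
      have "(\<Sum>s\<in>rank_patterns n k. ?T s x) = (\<Sum>s'\<in>rank_patterns n k. if s' = s then ?T s x else 0)"
      proof (rule sum.cong[OF refl])
        fix s' assume s': "s' \<in> rank_patterns n k"
        show "?T s' x = (if s' = s then ?T s x else 0)"
        proof (cases "s' = s")
          case False
          then have "\<not> rank_pattern n x (fst s') (snd s')" using uniq[OF s'] by blast
          with False show ?thesis by simp
        qed (simp only: if_True refl)
      qed
      also have "\<dots> = ?T s x" using s(1) finite_rank_patterns by simp
      also have "\<dots> = q (ostat n (k+1) x) * (\<Prod>i=1..k. g (ostat n i x) (ostat n (k+1) x))"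
      proof -
        have s': "(fst s, snd s) \<in> rank_patterns n k" using s(1) by simp
        show ?thesis
          unfolding ostat_rank_pattern(1)[OF s' s(2)]
            ostat_rank_pattern(2)[OF s' s(2), where g="\<lambda>u. g u (x (fst s))"]
          using s(2) by (simp only: if_True)
      qed
      finally show "q (ostat n (k+1) x) * (\<Prod>i=1..k. g (ostat n i x) (ostat n (k+1) x))
        = (\<Sum>s\<in>rank_patterns n k. ?T s x)" ..
    qed
  qed
  also have "\<dots> = (\<Sum>s\<in>rank_patterns n k. integral\<^sup>L (unif_cube n) (?T s))"
    by (rule Bochner_Integration.integral_sum)
      (rule P.integrable_const_bound[where B=B, OF AE_I2[OF TB]], rule Tm)
  also have "\<dots> = (\<Sum>s\<in>rank_patterns n k.
      (\<integral>v. q v * (\<integral>u. g (u * v) v \<partial>uniform01) ^ k * rank_density n k v \<partial>uniform01))"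
    by (intro sum.cong refl integral_rank_pattern[OF _ g g1 q qB]) simp
  finally show ?thesis by simp
qed

lemma norm_integral_le_integral_AE:
  fixes f :: "'a \<Rightarrow> 'b::{banach, second_countable_topology}"
  assumes "integrable M g" and le: "AE x in M. norm (f x) \<le> g x"
  shows "norm (integral\<^sup>L M f) \<le> integral\<^sup>L M g"
proof -
  have "AE x in M. 0 \<le> g x"
    using le by (rule eventually_mono) (rule order_trans[OF norm_ge_zero])
  then have "(\<integral>x. norm (f x) \<partial>M) \<le> integral\<^sup>L M g"
    using assms by (intro integral_mono_AE')
  then show ?thesis using integral_norm_bound order_trans by blast
qed

text \<open>The integral is an average of \<open>k\<close>-th powers over the law of the
  conditioning order statistic. Below \<open>v0\<close> the distance to \<open>c\<close> is at most
  \<open>\<delta>\<close>; from \<open>v0\<close> on, two numbers in the unit disc are at distance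
  at most \<open>2\<close>.\<close>

lemma integral_prod_ostat_close:
  fixes g :: "real \<Rightarrow> real \<Rightarrow> complex"
  assumes kn: "k < n"
    and g: "(\<lambda>z. g (fst z) (snd z)) \<in> borel_measurable (borel \<Otimes>\<^sub>M borel)"
    and g1: "\<And>u v. cmod (g u v) \<le> 1"
    and c: "cmod c \<le> 1" and \<delta>: "0 \<le> \<delta>"
    and close: "\<And>v. 0 < v \<Longrightarrow> v < 1 \<Longrightarrow> v < v0 \<Longrightarrow> cmod ((\<integral>u. g (u * v) v \<partial>uniform01) ^ k - c) \<le> \<delta>"
  shows "cmod ((\<integral>x. (\<Prod>i=1..k. g (ostat n i x) (ostat n (k+1) x)) \<partial>unif_cube n) - c)
    \<le> \<delta> + 2 * measure (unif_cube n) {x\<in>space (unif_cube n). v0 \<le> ostat n (k+1) x}"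
proof -
  interpret P: prob_space "unif_cube n" by (rule prob_space_unif_PiM)
  interpret u: prob_space uniform01 by (rule prob_space_uniform01)
  define N where "N = real (card (rank_patterns n k))"
  define \<psi> where "\<psi> v = (\<integral>u. g (u * v) v \<partial>uniform01)" for v
  let ?\<beta> = "rank_density n k"
  have [measurable]: "\<psi> \<in> borel_measurable uniform01"
  proof -
    have "(\<lambda>z. g (snd z * fst z) (fst z)) \<in> borel_measurable (uniform01 \<Otimes>\<^sub>M uniform01)"
      using measurable_compose[OF _ g, of "\<lambda>z. (snd z * fst z, fst z)" "uniform01 \<Otimes>\<^sub>M uniform01"] by simp
    then show ?thesis
      unfolding \<psi>_def by (intro u.borel_measurable_lebesgue_integral) (simp add: case_prod_beta')
  qed
  have \<psi>1: "cmod (\<psi> v) \<le> 1" for v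
  proof -
    have "cmod (\<psi> v) \<le> (\<integral>u. cmod (g (u * v) v) \<partial>uniform01)"
      unfolding \<psi>_def by (rule integral_norm_bound)
    also have "\<dots> \<le> (\<integral>u. 1 \<partial>uniform01)"
      by (rule Bochner_Integration.integral_mono') (auto simp: g1)
    finally show ?thesis by (simp add: u.prob_space[simplified])
  qed
  have \<psi>k1: "cmod (\<psi> v ^ k) \<le> 1" for v
    unfolding norm_power by (rule power_le_one) (auto simp: \<psi>1)
  have \<beta>01: "AE v in uniform01. 0 \<le> ?\<beta> v \<and> ?\<beta> v \<le> 1"
    using AE_uniform01 by (rule eventually_mono) (use rank_density_bounds in auto)
  have int\<psi>: "integrable uniform01 (\<lambda>v. \<psi> v ^ k * ?\<beta> v)"
  proof (rule u.integrable_const_bound[where B=1])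
    show "AE v in uniform01. norm (\<psi> v ^ k * ?\<beta> v) \<le> 1"
      using \<beta>01 by (rule eventually_mono) (use \<psi>k1 in \<open>auto simp: norm_mult intro!: mult_le_one\<close>)
  qed measurable
  have int\<beta>: "integrable uniform01 ?\<beta>"
  proof (rule u.integrable_const_bound[where B=1])
    show "AE v in uniform01. norm (?\<beta> v) \<le> 1"
      using \<beta>01 by (rule eventually_mono) auto
  qed measurable
  have intI: "integrable uniform01 (\<lambda>v. indicator {v0..} v * ?\<beta> v)"
  proof (rule u.integrable_const_bound[where B=1])
    show "AE v in uniform01. norm (indicator {v0..} v * ?\<beta> v) \<le> 1"
      using \<beta>01 by (rule eventually_mono) (auto simp: indicator_def)
  qed measurable
  have b: "(\<integral>x. (\<Prod>i=1..k. g (ostat n i x) (ostat n (k+1) x)) \<partial>unif_cube n)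
      = N * (\<integral>v. \<psi> v ^ k * ?\<beta> v \<partial>uniform01)"
    using integral_ostat[OF kn g g1, of "\<lambda>_. 1" 1] by (simp add: N_def \<psi>_def)
  \<comment> \<open>Taking all factors equal to one identifies \<open>N\<close> as the normalising
    constant of \<open>rank_density\<close>.\<close>
  have a: "N * (\<integral>v. ?\<beta> v \<partial>uniform01) = 1"
  proof -
    have "complex_of_real (N * (\<integral>v. ?\<beta> v \<partial>uniform01)) = of_real 1"
      using integral_ostat[OF kn, of "\<lambda>_ _. 1" "\<lambda>_. 1" 1]
      by (simp add: N_def P.prob_space[simplified] u.prob_space[simplified])
    then show ?thesis unfolding of_real_eq_iff .
  qed
  \<comment> \<open>With all factors one and \<open>q\<close> the indicator of the values from
    \<open>v0\<close> on, the same formula gives the tail probability.\<close>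
  have p: "N * (\<integral>v. indicator {v0..} v * ?\<beta> v \<partial>uniform01)
      = measure (unif_cube n) {x\<in>space (unif_cube n). v0 \<le> ostat n (k+1) x}" (is "_ = ?p")
  proof -
    have [measurable]: "ostat n (k+1) \<in> borel_measurable (unif_cube n)" by (rule measurable_ostat_unif)
    have "complex_of_real ?p = (\<integral>x. of_real (indicator {x\<in>space (unif_cube n). v0 \<le> ostat n (k+1) x} x) \<partial>unif_cube n)"
      by (subst integral_complex_of_real) (simp add: Int_def cong: conj_cong)
    also have "\<dots> = (\<integral>x. complex_of_real (indicator {v0..} (ostat n (k+1) x)) \<partial>unif_cube n)"
      by (intro Bochner_Integration.integral_cong) (auto simp: indicator_def)
    also have "\<dots> = of_real (N * (\<integral>v. indicator {v0..} v * ?\<beta> v \<partial>uniform01))"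
      using integral_ostat[OF kn, of "\<lambda>_ _. 1" "\<lambda>v. complex_of_real (indicator {v0..} v)" 1]
      by (simp add: N_def u.prob_space[simplified] indicator_def flip: of_real_mult, simp)
    finally show ?thesis unfolding of_real_eq_iff ..
  qed
  have "(\<integral>x. (\<Prod>i=1..k. g (ostat n i x) (ostat n (k+1) x)) \<partial>unif_cube n) - c
      = N * (\<integral>v. \<psi> v ^ k * ?\<beta> v \<partial>uniform01) - c * of_real (N * (\<integral>v. ?\<beta> v \<partial>uniform01))"
    unfolding a b by simp
  also have "\<dots> = N * (\<integral>v. \<psi> v ^ k * ?\<beta> v - c * ?\<beta> v \<partial>uniform01)"
    using int\<psi> int\<beta> by (subst Bochner_Integration.integral_diff) (auto simp: algebra_simps)
  finally have "cmod ((\<integral>x. (\<Prod>i=1..k. g (ostat n i x) (ostat n (k+1) x)) \<partial>unif_cube n) - c)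
      = N * cmod (\<integral>v. \<psi> v ^ k * ?\<beta> v - c * ?\<beta> v \<partial>uniform01)"
    by (simp add: norm_mult N_def)
  also have "\<dots> \<le> N * (\<integral>v. \<delta> * ?\<beta> v + 2 * (indicator {v0..} v * ?\<beta> v) \<partial>uniform01)"
  proof (rule mult_left_mono)
    show "cmod (\<integral>v. \<psi> v ^ k * ?\<beta> v - c * ?\<beta> v \<partial>uniform01)
        \<le> (\<integral>v. \<delta> * ?\<beta> v + 2 * (indicator {v0..} v * ?\<beta> v) \<partial>uniform01)"
    proof (rule norm_integral_le_integral_AE)
      show "integrable uniform01 (\<lambda>v. \<delta> * ?\<beta> v + 2 * (indicator {v0..} v * ?\<beta> v))"
        using int\<beta> intI by auto
      show "AE v in uniform01. cmod (\<psi> v ^ k * ?\<beta> v - c * ?\<beta> v)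
          \<le> \<delta> * ?\<beta> v + 2 * (indicator {v0..} v * ?\<beta> v)"
        using AE_uniform01
      proof (rule eventually_mono)
        fix v :: real assume v: "0 < v \<and> v < 1"
        then have \<beta>: "0 \<le> ?\<beta> v" using rank_density_bounds by blast
        have "cmod (\<psi> v ^ k - c) \<le> \<delta> + 2 * indicator {v0..} v"
        proof (cases "v < v0")
          case True
          then show ?thesis using close[of v] v by (simp add: \<psi>_def)
        next
          case False
          have "cmod (\<psi> v ^ k - c) \<le> 1 + 1" by (rule norm_triangle_le_diff) (use \<psi>k1[of v] c in linarith)
          then show ?thesis using False \<delta> by simp
        qed
        from mult_right_mono[OF this \<beta>]
        have "cmod (\<psi> v ^ k - c) * ?\<beta> v \<le> \<delta> * ?\<beta> v + 2 * (indicator {v0..} v * ?\<beta> v)"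
          by (simp only: distrib_right mult.assoc)
        moreover have "cmod (\<psi> v ^ k * ?\<beta> v - c * ?\<beta> v) = cmod (\<psi> v ^ k - c) * ?\<beta> v"
          using \<beta> by (simp only: left_diff_distrib[symmetric] norm_mult norm_of_real abs_of_nonneg)
        ultimately show "cmod (\<psi> v ^ k * ?\<beta> v - c * ?\<beta> v) \<le> \<delta> * ?\<beta> v + 2 * (indicator {v0..} v * ?\<beta> v)"
          by (simp only:)
      qed
    qed
  qed (simp add: N_def)
  also have "\<dots> = \<delta> * (N * (\<integral>v. ?\<beta> v \<partial>uniform01)) + 2 * (N * (\<integral>v. indicator {v0..} v * ?\<beta> v \<partial>uniform01))"
    using int\<beta> intI by (simp add: algebra_simps)
  finally show ?thesis unfolding a p by simp
qed

text \<open>An exponential Markov inequality. Weight each point below \<open>v0\<close> by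
  \<open>1/2\<close> and all others by \<open>1\<close>. On the event at most \<open>k\<close>
  points lie below \<open>v0\<close>, so the product of the weights is at least
  \<open>(1/2) ^ k\<close>, while by independence its mean is \<open>(1 - v0/2) ^ n\<close>.\<close>

lemma prob_ostat_ge_le:
  assumes kn: "k < n" and v0: "0 < v0" "v0 < 1"
  shows "measure (unif_cube n) {x\<in>space (unif_cube n). v0 \<le> ostat n (k+1) x} \<le> 2 ^ k * (1 - v0/2) ^ n"
proof -
  interpret P: prob_space "unif_cube n" by (rule prob_space_unif_PiM)
  interpret u: prob_space uniform01 by (rule prob_space_uniform01)
  interpret ps: product_prob_space "\<lambda>_. uniform01" "{1..n}" ..
  have [measurable]: "ostat n (k+1) \<in> borel_measurable (unif_cube n)" by (rule measurable_ostat_unif)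
  define f where "f a = 1 - indicator {..<v0} a / (2::real)" for a :: real
  have f01: "0 \<le> f a" "f a \<le> 1" for a by (auto simp: f_def indicator_def)
  have [measurable]: "f \<in> borel_measurable borel" unfolding f_def by measurable
  have fint: "integrable uniform01 f"
    by (rule u.integrable_const_bound[where B=1]) (use f01 in auto)
  have fm: "(\<lambda>x. \<Prod>j\<in>{1..n}. f (x j)) \<in> borel_measurable (unif_cube n)"
    by (intro borel_measurable_prod measurable_compose[OF measurable_unif_component]) auto
  have "measure (unif_cube n) {x\<in>space (unif_cube n). v0 \<le> ostat n (k+1) x}
      = (\<integral>x. indicator {x\<in>space (unif_cube n). v0 \<le> ostat n (k+1) x} x \<partial>unif_cube n)"
    by (simp add: Int_def cong: conj_cong)
  also have "\<dots> \<le> (\<integral>x. 2 ^ k * (\<Prod>j\<in>{1..n}. f (x j)) \<partial>unif_cube n)"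
  proof (rule integral_mono)
    show "integrable (unif_cube n) (\<lambda>x. 2 ^ k * (\<Prod>j\<in>{1..n}. f (x j)))"
      by (intro integrable_mult_right P.integrable_const_bound[where B=1] fm AE_I2)
        (auto simp: abs_prod f01 intro!: prod_le_1)
    fix x
    let ?L = "{j\<in>{1..n}. x j < v0}"
    have "1 \<le> 2 ^ k * (\<Prod>j\<in>{1..n}. f (x j))" if "v0 \<le> ostat n (k+1) x"
    proof -
      have "(ostat n (k+1) x < v0) = (k + 1 \<le> card ?L)"
        by (rule order_stat_iff) (use kn in auto)
      with that have "card ?L \<le> k" by linarith
      have "(\<Prod>j\<in>{1..n}. f (x j)) = (\<Prod>j\<in>{1..n}. if x j < v0 then 1/2 else 1)"
        by (intro prod.cong) (auto simp: f_def)
      also have "\<dots> = (1/2) ^ card ?L"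
        by (subst prod.inter_filter[symmetric]) auto
      also have "\<dots> \<ge> (1/2) ^ k" using \<open>card ?L \<le> k\<close> by (intro power_decreasing) auto
      finally have "(1/2) ^ k \<le> (\<Prod>j\<in>{1..n}. f (x j))" .
      from mult_left_mono[OF this, of "2 ^ k"] show ?thesis
        by (simp add: power_mult_distrib[symmetric])
    qed
    then show "indicator {x\<in>space (unif_cube n). v0 \<le> ostat n (k+1) x} x \<le> 2 ^ k * (\<Prod>j\<in>{1..n}. f (x j))"
      using mult_nonneg_nonneg[OF _ prod_nonneg[of "{1..n}" "\<lambda>j. f (x j)"], of "2 ^ k"] f01
      by (auto simp: indicator_def)
  next
    have "(\<lambda>x. indicator {x\<in>space (unif_cube n). v0 \<le> ostat n (k+1) x} x :: real) \<in> borel_measurable (unif_cube n)"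
      by measurable
    then show "integrable (unif_cube n) (\<lambda>x. indicator {x\<in>space (unif_cube n). v0 \<le> ostat n (k+1) x} x :: real)"
      by (rule P.integrable_const_bound[where B=1, rotated]) (simp add: indicator_def)
  qed
  also have "\<dots> = 2 ^ k * (\<Prod>j\<in>{1..n}. integral\<^sup>L uniform01 f)"
    using ps.product_integral_prod[OF finite_atLeastAtMost, of 1 n "\<lambda>_. f"] fint
    by (simp only: Bochner_Integration.integral_mult_right_zero)
  also have "integral\<^sup>L uniform01 f = 1 - v0 / 2"
  proof -
    have "integrable uniform01 (\<lambda>a. indicator {..<v0} a / 2 :: real)"
      by (rule u.integrable_const_bound[where B=1]) (auto simp: indicator_def)
    then show ?thesis
      unfolding f_def using measure_uniform01_lessThan[OF v0] u.prob_space
      by (subst Bochner_Integration.integral_diff) (auto simp: Int_absorb2)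
  qed
  finally show ?thesis by simp
qed

lemma order_stat_restrict:
  "order_stat U n i \<omega> = ostat n i (\<lambda>j\<in>{1..n}. U j \<omega>)"
proof -
  have "map (\<lambda>j. U j \<omega>) [1..<Suc n] = map (\<lambda>j. (\<lambda>j\<in>{1..n}. U j \<omega>) j) [1..<Suc n]"
    by (rule map_cong) auto
  then show ?thesis unfolding order_stat_def by metis
qed

text \<open>Independence makes the joint law of the first \<open>n\<close> variables the product of
  their laws. This moves expectations from the abstract space to the cube.\<close>

lemma (in prob_space) integral_unif_sample:
  fixes F :: "(nat \<Rightarrow> real) \<Rightarrow> 'b::{banach, second_countable_topology}"
  assumes indep: "indep_vars (\<lambda>_. borel) U {1..}"
    and distr: "\<And>i. i \<ge> 1 \<Longrightarrow> distr M borel (U i) = uniform01"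
    and n: "1 \<le> n" and F: "F \<in> borel_measurable (unif_cube n)"
  shows "(\<integral>\<omega>. F (\<lambda>j\<in>{1..n}. U j \<omega>) \<partial>M) = integral\<^sup>L (unif_cube n) F"
proof -
  have rv: "random_variable borel (U i)" if "i \<in> {1..n}" for i
    using indep that unfolding indep_vars_def2 by auto
  have I: "indep_vars (\<lambda>_. borel) U {1..n}"
    by (rule indep_vars_subset[OF indep]) auto
  have "{1..n} \<noteq> {}" using n by auto
  from indep_vars_iff_distr_eq_PiM'[OF this, of U "\<lambda>_. borel"] rv I
  have eq: "distr M (PiM {1..n} (\<lambda>_. borel)) (\<lambda>\<omega>. \<lambda>j\<in>{1..n}. U j \<omega>) = PiM {1..n} (\<lambda>i. distr M borel (U i))"
    by simp
  also have "\<dots> = unif_cube n"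
    by (intro PiM_cong refl distr) auto
  finally have eq: "distr M (PiM {1..n} (\<lambda>_. borel)) (\<lambda>\<omega>. \<lambda>j\<in>{1..n}. U j \<omega>) = unif_cube n" .
  have "sets (unif_cube n) = sets (PiM {1..n} (\<lambda>_. borel :: real measure))"
    by (intro sets_PiM_cong) auto
  then have F': "F \<in> borel_measurable (PiM {1..n} (\<lambda>_. borel))"
    using F by (simp cong: measurable_cong_sets)
  have "(\<lambda>\<omega>. \<lambda>j\<in>{1..n}. U j \<omega>) \<in> M \<rightarrow>\<^sub>M PiM {1..n} (\<lambda>_. borel)"
    by (rule measurable_restrict) (rule rv)
  from integral_distr[OF this F'] show ?thesis unfolding eq ..
qed

section \<open>Convergence via characteristic functions\<close>

text \<open>Once \<open>k n / n\<close> is below \<open>c / 2\<close>, the first factor is at most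
  \<open>exp (n * (c / 2))\<close>, which is outweighed by the bound \<open>exp (- n * c)\<close>
  for the second. With \<open>c = v/2\<close> this controls the probability that the conditioning
  order statistic is at least \<open>v\<close>.\<close>

lemma two_power_times_tendsto_0:
  fixes k :: "nat \<Rightarrow> nat"
  assumes k: "(\<lambda>n. real (k n) / real n) \<longlonglongrightarrow> 0" and c: "0 < c" "c < 1"
  shows "(\<lambda>n. 2 ^ k n * (1 - c) ^ n) \<longlonglongrightarrow> (0::real)"
proof (rule tendsto_sandwich[OF _ _ tendsto_const])
  show "\<forall>\<^sub>F n in sequentially. 0 \<le> 2 ^ k n * (1 - c) ^ n" using c by simp
  have "\<forall>\<^sub>F n in sequentially. real (k n) / real n < c / 2"
    using k c by (intro order_tendstoD) auto
  then show "\<forall>\<^sub>F n in sequentially. 2 ^ k n * (1 - c) ^ n \<le> exp (- (c / 2)) ^ n"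
    using eventually_gt_at_top[of 0]
  proof eventually_elim
    case (elim n)
    then have "real (k n) \<le> n * (c / 2)" by (simp add: field_simps)
    have "(2::real) ^ k n \<le> exp 1 ^ k n"
      using exp_ge_add_one_self[of 1] by (intro power_mono) auto
    also have "\<dots> = exp (real (k n))" by (simp flip: exp_of_nat_mult)
    also have "\<dots> \<le> exp (n * (c / 2))" using \<open>real (k n) \<le> n * (c / 2)\<close> by simp
    finally have 1: "(2::real) ^ k n \<le> exp (n * (c / 2))" .
    have "(1 - c) ^ n \<le> exp (- c) ^ n"
      using exp_ge_add_one_self[of "- c"] c by (intro power_mono) auto
    also have "\<dots> = exp (n * - c)" by (simp flip: exp_of_nat_mult)
    finally have 2: "(1 - c) ^ n \<le> exp (n * - c)" .
    have "2 ^ k n * (1 - c) ^ n \<le> exp (n * (c / 2)) * exp (n * - c)"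
      using 1 2 c by (intro mult_mono) auto
    also have "\<dots> = exp (n * - (c / 2))" by (simp flip: exp_add add: field_simps)
    also have "\<dots> = exp (- (c / 2)) ^ n" by (simp only: exp_of_nat_mult)
    finally show ?case .
  qed
  show "(\<lambda>n. exp (- (c / 2)) ^ n) \<longlonglongrightarrow> 0"
    using c by (intro LIMSEQ_realpow_zero) auto
qed

text \<open>The exponential of the sum is a product over the lower order statistics, so its mean is
  an average of \<open>k\<close>-th powers of one-summand characteristic functions. An estimate
  uniform over small \<open>v\<close> is enough because the conditioning order statistic exceeds any
  fixed level with vanishing probability. The second argument of \<open>h\<close> allows for random
  centring and scaling.\<close>

lemma (in prob_space) char_order_stat_sum_tendsto:
  fixes h :: "nat \<Rightarrow> real \<Rightarrow> real \<Rightarrow> real"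
  assumes indep: "indep_vars (\<lambda>_. borel) U {1..}"
    and distr: "\<And>i. i \<ge> 1 \<Longrightarrow> distr M borel (U i) = uniform01"
    and hm: "\<And>n. (\<lambda>z. h n (fst z) (snd z)) \<in> borel_measurable (borel \<Otimes>\<^sub>M borel)"
    and k: "(\<lambda>n. real (k n) / real n) \<longlonglongrightarrow> 0"
    and \<phi>: "cmod \<phi> \<le> 1"
    and close: "\<And>\<delta>. \<delta> > 0 \<Longrightarrow> \<exists>v0>0. \<forall>\<^sub>F n in sequentially. \<forall>v. 0 < v \<and> v < v0 \<longrightarrow>
        cmod (char (distr uniform01 borel (\<lambda>u. h n (u * v) v)) t ^ k n - \<phi>) \<le> \<delta>"
  shows "(\<lambda>n. char (distr M borel (\<lambda>\<omega>. \<Sum>i=1..k n.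
      h n (order_stat U n i \<omega>) (order_stat U n (k n + 1) \<omega>))) t) \<longlonglongrightarrow> \<phi>"
proof (rule tendstoI)
  fix \<epsilon> :: real assume \<epsilon>: "\<epsilon> > 0"
  obtain v0 where v0: "v0 > 0" and
    ev: "\<forall>\<^sub>F n in sequentially. \<forall>v. 0 < v \<and> v < v0 \<longrightarrow>
      cmod (char (distr uniform01 borel (\<lambda>u. h n (u * v) v)) t ^ k n - \<phi>) \<le> \<epsilon>/2"
    using close[of "\<epsilon>/2"] \<epsilon> by auto
  \<comment> \<open>The cap at \<open>1/2\<close> brings the threshold into the open unit interval,
    as the tail bound requires.\<close>
  define v1 where "v1 = min v0 (1/2)"
  have v1: "0 < v1" "v1 < 1" "v1 \<le> v0" using v0 by (auto simp: v1_def)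
  have "\<forall>\<^sub>F n in sequentially. 2 ^ k n * (1 - v1/2) ^ n < \<epsilon>/4"
    using two_power_times_tendsto_0[OF k, of "v1/2"] v1 \<epsilon> by (intro order_tendstoD) auto
  moreover have "\<forall>\<^sub>F n in sequentially. real (k n) / real n < 1"
    using k by (intro order_tendstoD) auto
  ultimately show "\<forall>\<^sub>F n in sequentially. dist (char (distr M borel (\<lambda>\<omega>. \<Sum>i=1..k n.
      h n (order_stat U n i \<omega>) (order_stat U n (k n + 1) \<omega>))) t) \<phi> < \<epsilon>"
    using ev eventually_gt_at_top[of 0]
  proof eventually_elim
    case (elim n)
    have n: "1 \<le> n" and kn: "k n < n" using elim(2,4) by (auto simp: field_simps)
    define g where "g u v = iexp (t * h n u v)" for u v
    have gm: "(\<lambda>z. g (fst z) (snd z)) \<in> borel_measurable (borel \<Otimes>\<^sub>M borel)"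
      unfolding g_def using hm[of n] by measurable
    have g1: "cmod (g u v) \<le> 1" for u v by (simp add: g_def)
    have Um: "U j \<in> borel_measurable M" if "j \<in> {1..n}" for j
      using indep that unfolding indep_vars_def2 by auto
    have Xm: "(\<lambda>\<omega>. \<Sum>i=1..k n. h n (order_stat U n i \<omega>) (order_stat U n (k n + 1) \<omega>)) \<in> borel_measurable M"
    proof (rule borel_measurable_sum)
      fix i
      have "(\<lambda>\<omega>. (order_stat U n i \<omega>, order_stat U n (k n + 1) \<omega>)) \<in> M \<rightarrow>\<^sub>M borel \<Otimes>\<^sub>M borel"
        by (intro measurable_Pair measurable_order_stat Um)
      from measurable_compose[OF this hm[of n]]
      show "(\<lambda>\<omega>. h n (order_stat U n i \<omega>) (order_stat U n (k n + 1) \<omega>)) \<in> borel_measurable M" by simp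
    qed
    have "char (distr M borel (\<lambda>\<omega>. \<Sum>i=1..k n. h n (order_stat U n i \<omega>) (order_stat U n (k n + 1) \<omega>))) t
        = (\<integral>\<omega>. iexp (t * (\<Sum>i=1..k n. h n (order_stat U n i \<omega>) (order_stat U n (k n + 1) \<omega>))) \<partial>M)"
      unfolding char_def by (rule integral_distr[OF Xm]) measurable
    also have "\<dots> = (\<integral>\<omega>. (\<Prod>i=1..k n. g (order_stat U n i \<omega>) (order_stat U n (k n + 1) \<omega>)) \<partial>M)"
      unfolding g_def by (simp add: sum_distrib_left exp_sum[symmetric])
    also have "\<dots> = (\<integral>\<omega>. (\<lambda>x. \<Prod>i=1..k n. g (ostat n i x) (ostat n (k n + 1) x)) (\<lambda>j\<in>{1..n}. U j \<omega>) \<partial>M)"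
      unfolding order_stat_restrict[of U] ..
    also have "\<dots> = (\<integral>x. (\<Prod>i=1..k n. g (ostat n i x) (ostat n (k n + 1) x)) \<partial>unif_cube n)"
      by (rule integral_unif_sample[OF indep distr n measurable_prod_ostat[OF gm]])
    finally have eq: "char (distr M borel (\<lambda>\<omega>. \<Sum>i=1..k n.
        h n (order_stat U n i \<omega>) (order_stat U n (k n + 1) \<omega>))) t
      = (\<integral>x. (\<Prod>i=1..k n. g (ostat n i x) (ostat n (k n + 1) x)) \<partial>unif_cube n)" .
    have "cmod ((\<integral>x. (\<Prod>i=1..k n. g (ostat n i x) (ostat n (k n + 1) x)) \<partial>unif_cube n) - \<phi>)
      \<le> \<epsilon>/2 + 2 * measure (unif_cube n) {x\<in>space (unif_cube n). v1 \<le> ostat n (k n + 1) x}"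
    proof (rule integral_prod_ostat_close[OF kn gm g1 \<phi>])
      fix v :: real assume v: "0 < v" "v < 1" "v < v1"
      have "(\<lambda>u. h n (u * v) v) \<in> borel_measurable uniform01"
        using measurable_compose[OF _ hm[of n], of "\<lambda>u. (u * v, v)" uniform01] by simp
      then have "(\<integral>u. g (u * v) v \<partial>uniform01) = char (distr uniform01 borel (\<lambda>u. h n (u * v) v)) t"
        unfolding char_def g_def by (subst integral_distr) auto
      then show "cmod ((\<integral>u. g (u * v) v \<partial>uniform01) ^ k n - \<phi>) \<le> \<epsilon>/2"
        using elim(3) v v1 by auto
    qed (use \<epsilon> in auto)
    then show ?case
      using prob_ostat_ge_le[OF kn v1(1,2)] elim(1) unfolding eq dist_norm by linarith
  qed
qed

text \<open>Levy's theorem gives weak convergence to the point mass at \<open>c\<close>. Its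
  distribution function is continuous at \<open>c - \<epsilon>\<close> and
  \<open>c + \<epsilon>\<close>, and convergence at these two points bounds the probability of a
  deviation.\<close>

lemma (in prob_space) conv_in_prob_if_char_tendsto:
  assumes X[measurable]: "\<And>n. X n \<in> borel_measurable M"
    and lim: "\<And>t. (\<lambda>n. char (distr M borel (X n)) t) \<longlonglongrightarrow> iexp (t * c)"
  shows "conv_in_prob M X c"
proof -
  let ?R = "return borel c :: real measure"
  interpret R: prob_space ?R by (rule prob_space_return) simp
  have R: "real_distribution ?R"
    by unfold_locales simp
  have dX: "real_distribution (distr M borel (X n))" for n
    by (rule real_distribution_distr) simp
  have "char ?R t = iexp (t * c)" for t
    unfolding char_def by (subst integral_return) auto
  then have wc: "weak_conv_m (\<lambda>n. distr M borel (X n)) ?R"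
    using lim by (intro levy_continuity dX R) simp
  have cdfR: "cdf ?R x = (if c \<le> x then 1 else 0)" for x
    unfolding cdf_def by (subst measure_return) (auto simp: indicator_def)
  have cdfX: "cdf (distr M borel (X n)) x = prob {\<omega>\<in>space M. X n \<omega> \<le> x}" for n x
    unfolding cdf_def by (subst measure_distr) (auto intro!: arg_cong[where f=prob])
  have "isCont (cdf ?R) x" if "x \<noteq> c" for x
  proof (cases "x < c")
    case True
    then have "\<forall>\<^sub>F y in nhds x. y < c"
      using eventually_nhds_in_open[of "{..<c}" x] by simp
    then have "\<forall>\<^sub>F y in nhds x. cdf ?R y = 0" by (rule eventually_mono) (simp add: cdfR)
    then show ?thesis by (subst isCont_cong) auto
  next
    case False
    with that have "c < x" by simp
    then have "\<forall>\<^sub>F y in nhds x. c < y"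
      using eventually_nhds_in_open[of "{c<..}" x] by simp
    then have "\<forall>\<^sub>F y in nhds x. cdf ?R y = 1" by (rule eventually_mono) (simp add: cdfR)
    then show ?thesis by (subst isCont_cong) auto
  qed
  then have lim_cdf: "(\<lambda>n. prob {\<omega>\<in>space M. X n \<omega> \<le> x}) \<longlonglongrightarrow> (if c \<le> x then 1 else 0)" if "x \<noteq> c" for x
    using wc that unfolding weak_conv_m_def weak_conv_def cdfX cdfR by auto
  have "(\<lambda>n. prob {\<omega>\<in>space M. \<bar>X n \<omega> - c\<bar> > \<epsilon>}) \<longlonglongrightarrow> 0" if \<epsilon>: "\<epsilon> > 0" for \<epsilon>
  proof (rule tendsto_sandwich[OF _ _ tendsto_const])
    show "\<forall>\<^sub>F n in sequentially. 0 \<le> prob {\<omega>\<in>space M. \<bar>X n \<omega> - c\<bar> > \<epsilon>}" by simp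
    have "prob {\<omega>\<in>space M. \<bar>X n \<omega> - c\<bar> > \<epsilon>}
      \<le> prob {\<omega>\<in>space M. X n \<omega> \<le> c - \<epsilon>} + (1 - prob {\<omega>\<in>space M. X n \<omega> \<le> c + \<epsilon>})" for n
    proof -
      have "prob {\<omega>\<in>space M. \<bar>X n \<omega> - c\<bar> > \<epsilon>}
        \<le> prob ({\<omega>\<in>space M. X n \<omega> \<le> c - \<epsilon>} \<union> (space M - {\<omega>\<in>space M. X n \<omega> \<le> c + \<epsilon>}))"
        by (rule finite_measure_mono) (auto simp: abs_real_def split: if_splits)
      also have "\<dots> \<le> prob {\<omega>\<in>space M. X n \<omega> \<le> c - \<epsilon>} + prob (space M - {\<omega>\<in>space M. X n \<omega> \<le> c + \<epsilon>})"
        by (rule measure_Un_le) auto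
      also have "prob (space M - {\<omega>\<in>space M. X n \<omega> \<le> c + \<epsilon>}) = 1 - prob {\<omega>\<in>space M. X n \<omega> \<le> c + \<epsilon>}"
        by (rule prob_compl) simp
      finally show ?thesis .
    qed
    then show "\<forall>\<^sub>F n in sequentially. prob {\<omega>\<in>space M. \<bar>X n \<omega> - c\<bar> > \<epsilon>}
      \<le> prob {\<omega>\<in>space M. X n \<omega> \<le> c - \<epsilon>} + (1 - prob {\<omega>\<in>space M. X n \<omega> \<le> c + \<epsilon>})" by simp
    show "(\<lambda>n. prob {\<omega>\<in>space M. X n \<omega> \<le> c - \<epsilon>} + (1 - prob {\<omega>\<in>space M. X n \<omega> \<le> c + \<epsilon>})) \<longlonglongrightarrow> 0"
      using tendsto_add[OF lim_cdf[of "c - \<epsilon>"] tendsto_diff[OF tendsto_const[of 1] lim_cdf[of "c + \<epsilon>"]]] \<epsilon>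
      by simp
  qed
  then show ?thesis unfolding conv_in_prob_def using X by simp
qed

section \<open>Characteristic functions of iid sums\<close>

text \<open>Interpolation between two Taylor bounds: if \<open>y\<close> is at most \<open>1\<close>
  then \<open>y\<close> is at most \<open>y powr e\<close>, otherwise \<open>1\<close> is. The
  factor \<open>c\<close> absorbs the constants \<open>4\<close> and \<open>6\<close> of the two
  remainders below.\<close>

lemma min_scaled_le_powr:
  fixes b c y e :: real
  assumes "0 \<le> b" "1 \<le> c" "0 \<le> y" "0 < e" "e \<le> 1"
  shows "min (c * b) (b * y) \<le> c * b * y powr e"
proof (cases "y \<le> 1")
  case True
  have "y \<le> y powr e"
  proof (cases "y = 0")
    case False
    then have "y powr 1 \<le> y powr e"
      using assms True by (intro powr_mono') auto
    then show ?thesis using assms False by simp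
  qed simp
  then have "b * y \<le> b * y powr e" using assms by (intro mult_left_mono)
  also have "\<dots> \<le> c * (b * y powr e)" using assms mult_right_mono[of 1 c "b * y powr e"] by simp
  finally show ?thesis by (simp add: mult.assoc)
next
  case False
  then have "1 \<le> y powr e" using assms by (simp add: ge_one_powr_ge_zero)
  then have "c * b * 1 \<le> c * b * y powr e" using assms by (intro mult_left_mono) auto
  then show ?thesis by simp
qed

text \<open>For the upper bound on \<open>exp (- y)\<close>, multiply \<open>1 - y + y^2/2\<close>
  by \<open>1 + y + y^2/2\<close>: the product is \<open>1 + y^4/4\<close>, at least
  \<open>1\<close>, and the second factor is at most \<open>exp y\<close>.\<close>

lemma exp_minus_quadratic_bound:
  fixes y :: real
  assumes "0 \<le> y"
  shows "\<bar>1 - y - exp (- y)\<bar> \<le> y\<^sup>2 / 2"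
proof -
  have "exp (- y) \<le> 1 - y + y\<^sup>2/2"
  proof -
    have e: "1 + y + y\<^sup>2/2 \<le> exp y" using assms by (rule exp_lower_Taylor_quadratic)
    have "(1 - y + y\<^sup>2/2) * (1 + y + y\<^sup>2/2) = 1 + (y\<^sup>2)\<^sup>2/4"
      by (simp add: algebra_simps power2_eq_square)
    then have "1 \<le> (1 - y + y\<^sup>2/2) * (1 + y + y\<^sup>2/2)" by simp
    also have "\<dots> \<le> (1 - y + y\<^sup>2/2) * exp y"
    proof (rule mult_left_mono[OF e])
      have "1 - y + y\<^sup>2/2 = (1 - y)\<^sup>2 / 2 + 1/2" by (simp add: power2_eq_square field_simps)
      then show "0 \<le> 1 - y + y\<^sup>2/2" by simp
    qed
    finally show ?thesis by (simp add: exp_minus field_simps)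
  qed
  moreover have "1 - y \<le> exp (- y)" using exp_ge_add_one_self[of "-y"] by simp
  ultimately show ?thesis by (simp add: abs_real_def)
qed

text \<open>The power of \<open>k\<close> left after adding \<open>k\<close> remainders of order
  \<open>r\<close>: \<open>c = 1\<close> is the scaling of the law of large numbers,
  \<open>c = 1/2\<close> that of the central limit theorem.\<close>

lemma powr_div_of_nat_mult:
  assumes "0 < (k::real)"
  shows "k * \<bar>t / k powr c\<bar> powr r = \<bar>t\<bar> powr r * k powr (1 - c * r)"
proof -
  have "\<bar>t / k powr c\<bar> powr r = \<bar>t\<bar> powr r / k powr (c * r)"
    using assms by (simp add: powr_divide powr_powr)
  then show ?thesis using assms by (simp add: powr_diff)
qed

text \<open>The elementary estimate \<open>min 1 y \<le> y powr (r - 1)\<close> turns the Taylor remainder of the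
  characteristic function into an absolute moment of order \<open>r\<close>.\<close>

lemma (in prob_space) char_mean_bound:
  assumes X[measurable]: "random_variable borel X" and r: "1 < r" "r \<le> 2"
    and int1: "integrable M X" and mean: "expectation X = 1"
    and intr: "integrable M (\<lambda>\<omega>. \<bar>X \<omega>\<bar> powr r)" and k: "1 \<le> k"
  shows "cmod (char (distr M borel (\<lambda>\<omega>. X \<omega> / real k)) t ^ k - iexp t)
    \<le> 2 * \<bar>t\<bar> powr r * (real k powr (1 - r) * expectation (\<lambda>\<omega>. \<bar>X \<omega>\<bar> powr r)) + t\<^sup>2 / (2 * real k)"
proof -
  let ?D = "distr M borel X"
  interpret D: real_distribution ?D by (rule real_distribution_distr) simp
  interpret Dk: real_distribution "distr M borel (\<lambda>\<omega>. X \<omega> / real k)"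
    by (rule real_distribution_distr) simp
  define s where "s = t / real k"
  have ch: "char (distr M borel (\<lambda>\<omega>. X \<omega> / real k)) t = char ?D s"
    unfolding char_def s_def by (subst (1 2) integral_distr) (auto simp: mult_ac)
  have mom: "integrable ?D (\<lambda>x. x ^ j)" if "j \<le> 1" for j
    using that int1 by (cases j) (auto simp: integrable_distr_eq)
  have mean': "D.expectation (\<lambda>x. x) = 1" using mean by (simp add: integral_distr)
  have "cmod (char ?D s - (1 + \<i> * s))
      \<le> \<bar>s\<bar> / 2 * D.expectation (\<lambda>x. min (4 * \<bar>x\<bar>) (\<bar>s\<bar> * x\<^sup>2))"
    using D.char_approx2[of 1 s, OF mom] D.prob_space by (simp add: mean' mult.commute power2_eq_square)
  also have "\<dots> \<le> \<bar>s\<bar> / 2 * (4 * \<bar>s\<bar> powr (r - 1) * expectation (\<lambda>\<omega>. \<bar>X \<omega>\<bar> powr r))"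
  proof (rule mult_left_mono)
    have "D.expectation (\<lambda>x. min (4 * \<bar>x\<bar>) (\<bar>s\<bar> * x\<^sup>2))
        = expectation (\<lambda>\<omega>. min (4 * \<bar>X \<omega>\<bar>) (\<bar>s\<bar> * (X \<omega>)\<^sup>2))"
      by (subst integral_distr) auto
    also have "\<dots> \<le> expectation (\<lambda>\<omega>. 4 * \<bar>s\<bar> powr (r - 1) * \<bar>X \<omega>\<bar> powr r)"
    proof (rule integral_mono_AE')
      show "integrable M (\<lambda>\<omega>. 4 * \<bar>s\<bar> powr (r - 1) * \<bar>X \<omega>\<bar> powr r)" using intr by simp
      have "min (4 * \<bar>x\<bar>) (\<bar>s\<bar> * x\<^sup>2) \<le> 4 * \<bar>s\<bar> powr (r - 1) * \<bar>x\<bar> powr r" for x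
      proof -
        have "\<bar>s\<bar> * x\<^sup>2 = \<bar>x\<bar> * (\<bar>s\<bar> * \<bar>x\<bar>)"
          by (simp add: power2_eq_square abs_mult_self_eq)
        then have "min (4 * \<bar>x\<bar>) (\<bar>s\<bar> * x\<^sup>2) \<le> 4 * \<bar>x\<bar> * (\<bar>s\<bar> * \<bar>x\<bar>) powr (r - 1)"
          using r by (simp only:) (rule min_scaled_le_powr, auto)
        also have "\<dots> = 4 * \<bar>s\<bar> powr (r - 1) * (\<bar>x\<bar> powr 1 * \<bar>x\<bar> powr (r - 1))"
          by (simp add: powr_mult)
        also have "\<bar>x\<bar> powr 1 * \<bar>x\<bar> powr (r - 1) = \<bar>x\<bar> powr r"
          unfolding powr_add[symmetric] by simp
        finally show ?thesis .
      qed
      then show "AE \<omega> in M. min (4 * \<bar>X \<omega>\<bar>) (\<bar>s\<bar> * (X \<omega>)\<^sup>2) \<le> 4 * \<bar>s\<bar> powr (r - 1) * \<bar>X \<omega>\<bar> powr r"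
        by simp
    qed auto
    finally show "D.expectation (\<lambda>x. min (4 * \<bar>x\<bar>) (\<bar>s\<bar> * x\<^sup>2))
        \<le> 4 * \<bar>s\<bar> powr (r - 1) * expectation (\<lambda>\<omega>. \<bar>X \<omega>\<bar> powr r)" by simp
  qed simp
  also have "\<dots> = 2 * (\<bar>s\<bar> powr 1 * \<bar>s\<bar> powr (r - 1)) * expectation (\<lambda>\<omega>. \<bar>X \<omega>\<bar> powr r)" by simp
  also have "\<bar>s\<bar> powr 1 * \<bar>s\<bar> powr (r - 1) = \<bar>s\<bar> powr r" unfolding powr_add[symmetric] by simp
  finally have 1: "cmod (char ?D s - (1 + \<i> * s)) \<le> 2 * \<bar>s\<bar> powr r * expectation (\<lambda>\<omega>. \<bar>X \<omega>\<bar> powr r)" .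
  have 2: "cmod (iexp s - (1 + \<i> * s)) \<le> s\<^sup>2 / 2"
    using iexp_approx1[of s 1] by (simp add: power2_eq_square abs_mult_self_eq)
  \<comment> \<open>The limit is itself the \<open>k\<close>-th power of \<open>iexp s\<close>,
    which has the same first-order expansion at \<open>s\<close>. Comparing bases in the unit disc
    costs only a factor \<open>k\<close>.\<close>
  have "char (distr M borel (\<lambda>\<omega>. X \<omega> / real k)) t ^ k - iexp t = char ?D s ^ k - iexp s ^ k"
    unfolding ch using k by (simp add: s_def exp_of_nat_mult[symmetric])
  also have "cmod \<dots> \<le> real k * cmod (char ?D s - iexp s)"
    by (rule norm_power_diff) (auto simp: D.cmod_char_le_1)
  also have "\<dots> \<le> real k * (2 * \<bar>s\<bar> powr r * expectation (\<lambda>\<omega>. \<bar>X \<omega>\<bar> powr r) + s\<^sup>2 / 2)"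
  proof (rule mult_left_mono)
    have "char ?D s - iexp s = (char ?D s - (1 + \<i> * s)) - (iexp s - (1 + \<i> * s))" by simp
    also have "cmod \<dots> \<le> 2 * \<bar>s\<bar> powr r * expectation (\<lambda>\<omega>. \<bar>X \<omega>\<bar> powr r) + s\<^sup>2 / 2"
      by (rule order_trans[OF norm_triangle_ineq4]) (use 1 2 in linarith)
    finally show "cmod (char ?D s - iexp s) \<le> 2 * \<bar>s\<bar> powr r * expectation (\<lambda>\<omega>. \<bar>X \<omega>\<bar> powr r) + s\<^sup>2 / 2" .
  qed simp
  also have "\<dots> = 2 * (real k * \<bar>t / real k powr 1\<bar> powr r) * expectation (\<lambda>\<omega>. \<bar>X \<omega>\<bar> powr r) + real k * (s\<^sup>2 / 2)"
    using k by (simp add: s_def algebra_simps)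
  also have "real k * \<bar>t / real k powr 1\<bar> powr r = \<bar>t\<bar> powr r * real k powr (1 - r)"
    using powr_div_of_nat_mult[of "real k" t 1 r] k by simp
  also have "real k * (s\<^sup>2 / 2) = t\<^sup>2 / (2 * real k)"
    using k by (simp add: s_def power2_eq_square)
  finally show ?thesis by (simp add: mult.assoc)
qed

text \<open>A Lyapunov-type bound with explicit error. The Taylor remainder of the characteristic
  function is interpolated to an absolute moment of order \<open>r\<close>; replacing
  \<open>1 - s^2/2\<close> by the Gaussian factor \<open>exp (- s^2/2)\<close> costs the term in
  \<open>t ^ 4\<close>.\<close>

lemma (in prob_space) char_standardized_bound:
  assumes X[measurable]: "random_variable borel X" and r: "2 < r" "r \<le> 3"
    and int1: "integrable M X" and mean: "expectation X = 0"
    and int2: "integrable M (\<lambda>\<omega>. (X \<omega>)\<^sup>2)" and var: "expectation (\<lambda>\<omega>. (X \<omega>)\<^sup>2) = 1"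
    and intr: "integrable M (\<lambda>\<omega>. \<bar>X \<omega>\<bar> powr r)" and k: "1 \<le> k"
  shows "cmod (char (distr M borel (\<lambda>\<omega>. X \<omega> / sqrt (real k))) t ^ k - exp (- (t\<^sup>2) / 2))
    \<le> \<bar>t\<bar> powr r * (real k powr (1 - r / 2) * expectation (\<lambda>\<omega>. \<bar>X \<omega>\<bar> powr r)) + t ^ 4 / (8 * real k)"
proof -
  let ?D = "distr M borel X"
  interpret D: real_distribution ?D by (rule real_distribution_distr) simp
  define s where "s = t / sqrt (real k)"
  have ch: "char (distr M borel (\<lambda>\<omega>. X \<omega> / sqrt (real k))) t = char ?D s"
    unfolding char_def s_def by (subst (1 2) integral_distr) (auto simp: mult_ac)
  have "cmod (char ?D s - (1 - s\<^sup>2 * 1 / 2))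
      \<le> (s\<^sup>2 / 6) * expectation (\<lambda>\<omega>. min (6 * (X \<omega>)\<^sup>2) (\<bar>s\<bar> * \<bar>X \<omega>\<bar> ^ 3))"
    by (rule char_approx3'[OF X int1 int2 mean _ refl]) (simp add: mean var)
  also have "\<dots> \<le> (s\<^sup>2 / 6) * (6 * \<bar>s\<bar> powr (r - 2) * expectation (\<lambda>\<omega>. \<bar>X \<omega>\<bar> powr r))"
  proof (rule mult_left_mono)
    have "expectation (\<lambda>\<omega>. min (6 * (X \<omega>)\<^sup>2) (\<bar>s\<bar> * \<bar>X \<omega>\<bar> ^ 3))
      \<le> expectation (\<lambda>\<omega>. 6 * \<bar>s\<bar> powr (r - 2) * \<bar>X \<omega>\<bar> powr r)"
    proof (rule integral_mono_AE')
      show "integrable M (\<lambda>\<omega>. 6 * \<bar>s\<bar> powr (r - 2) * \<bar>X \<omega>\<bar> powr r)" using intr by simp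
      have "min (6 * x\<^sup>2) (\<bar>s\<bar> * \<bar>x\<bar> ^ 3) \<le> 6 * \<bar>s\<bar> powr (r - 2) * \<bar>x\<bar> powr r" for x
      proof -
        have "\<bar>s\<bar> * \<bar>x\<bar> ^ 3 = x\<^sup>2 * (\<bar>s\<bar> * \<bar>x\<bar>)"
          using abs_mult_self_eq[of x] by (simp add: power3_eq_cube power2_eq_square)
        then have "min (6 * x\<^sup>2) (\<bar>s\<bar> * \<bar>x\<bar> ^ 3) \<le> 6 * x\<^sup>2 * (\<bar>s\<bar> * \<bar>x\<bar>) powr (r - 2)"
          using r by (simp only:) (rule min_scaled_le_powr, auto)
        also have "\<dots> = 6 * \<bar>s\<bar> powr (r - 2) * (\<bar>x\<bar> powr 2 * \<bar>x\<bar> powr (r - 2))"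
          by (simp add: powr_mult)
        also have "\<bar>x\<bar> powr 2 * \<bar>x\<bar> powr (r - 2) = \<bar>x\<bar> powr r"
          unfolding powr_add[symmetric] by simp
        finally show ?thesis .
      qed
      then show "AE \<omega> in M. min (6 * (X \<omega>)\<^sup>2) (\<bar>s\<bar> * \<bar>X \<omega>\<bar> ^ 3) \<le> 6 * \<bar>s\<bar> powr (r - 2) * \<bar>X \<omega>\<bar> powr r"
        by simp
    qed auto
    then show "expectation (\<lambda>\<omega>. min (6 * (X \<omega>)\<^sup>2) (\<bar>s\<bar> * \<bar>X \<omega>\<bar> ^ 3))
        \<le> 6 * \<bar>s\<bar> powr (r - 2) * expectation (\<lambda>\<omega>. \<bar>X \<omega>\<bar> powr r)" by simp
  qed simp
  also have "\<dots> = (\<bar>s\<bar> powr 2 * \<bar>s\<bar> powr (r - 2)) * expectation (\<lambda>\<omega>. \<bar>X \<omega>\<bar> powr r)" by simp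
  also have "\<bar>s\<bar> powr 2 * \<bar>s\<bar> powr (r - 2) = \<bar>s\<bar> powr r" unfolding powr_add[symmetric] by simp
  finally have 1: "cmod (char ?D s - (1 - s\<^sup>2 / 2)) \<le> \<bar>s\<bar> powr r * expectation (\<lambda>\<omega>. \<bar>X \<omega>\<bar> powr r)"
    by simp
  have 2: "cmod ((1 - s\<^sup>2 / 2) - exp (- (s\<^sup>2 / 2))) \<le> s ^ 4 / 8"
  proof -
    have "\<bar>1 - s\<^sup>2 / 2 - exp (- (s\<^sup>2 / 2))\<bar> \<le> (s\<^sup>2 / 2)\<^sup>2 / 2"
      by (rule exp_minus_quadratic_bound) simp
    also have "(s\<^sup>2 / 2)\<^sup>2 / 2 = s ^ 4 / 8" by (simp add: power_divide flip: power_mult)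
    also have "\<bar>1 - s\<^sup>2 / 2 - exp (- (s\<^sup>2 / 2))\<bar> = cmod (of_real (1 - s\<^sup>2 / 2 - exp (- (s\<^sup>2 / 2))))"
      by (simp only: norm_of_real)
    finally show ?thesis by simp
  qed
  have s2: "real k * s\<^sup>2 = t\<^sup>2" using k by (simp add: s_def power_divide)
  have "exp (- (t\<^sup>2) / 2) = exp (- (s\<^sup>2 / 2)) ^ k"
    unfolding s2[symmetric] by (simp flip: exp_of_nat_mult)
  then have "char (distr M borel (\<lambda>\<omega>. X \<omega> / sqrt (real k))) t ^ k - exp (- (t\<^sup>2) / 2)
      = char ?D s ^ k - complex_of_real (exp (- (s\<^sup>2 / 2))) ^ k"
    unfolding ch by simp
  also have "cmod \<dots> \<le> real k * cmod (char ?D s - complex_of_real (exp (- (s\<^sup>2 / 2))))"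
    by (rule norm_power_diff) (auto simp: D.cmod_char_le_1)
  also have "\<dots> \<le> real k * (\<bar>s\<bar> powr r * expectation (\<lambda>\<omega>. \<bar>X \<omega>\<bar> powr r) + s ^ 4 / 8)"
  proof (rule mult_left_mono)
    have "char ?D s - complex_of_real (exp (- (s\<^sup>2 / 2)))
        = (char ?D s - (1 - s\<^sup>2 / 2)) + ((1 - s\<^sup>2 / 2) - exp (- (s\<^sup>2 / 2)))" by simp
    also have "cmod \<dots> \<le> \<bar>s\<bar> powr r * expectation (\<lambda>\<omega>. \<bar>X \<omega>\<bar> powr r) + s ^ 4 / 8"
      by (rule order_trans[OF norm_triangle_ineq]) (use 1 2 in linarith)
    finally show "cmod (char ?D s - complex_of_real (exp (- (s\<^sup>2 / 2))))
      \<le> \<bar>s\<bar> powr r * expectation (\<lambda>\<omega>. \<bar>X \<omega>\<bar> powr r) + s ^ 4 / 8" .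
  qed simp
  also have "\<dots> = (real k * \<bar>t / real k powr (1/2)\<bar> powr r) * expectation (\<lambda>\<omega>. \<bar>X \<omega>\<bar> powr r) + real k * (s ^ 4 / 8)"
    using k by (simp add: s_def algebra_simps powr_half_sqrt)
  also have "real k * \<bar>t / real k powr (1/2)\<bar> powr r = \<bar>t\<bar> powr r * real k powr (1 - r / 2)"
    using powr_div_of_nat_mult[of "real k" t "1/2" r] k by simp
  also have "real k * (s ^ 4 / 8) = t ^ 4 / (8 * real k)"
  proof -
    have "real k * s ^ 4 = (real k * s\<^sup>2) * s\<^sup>2" by (simp flip: power_add)
    also have "\<dots> = t\<^sup>2 * (t\<^sup>2 / real k)" unfolding s2 using k by (simp add: s_def power_divide)
    also have "\<dots> = t ^ 4 / real k" by (simp flip: power_add)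
    finally show ?thesis by simp
  qed
  finally show ?thesis by (simp add: mult.assoc)
qed

section \<open>Regularly varying quantile functions\<close>

lemma quantile_mono:
  assumes "real_distribution D" "0 < s" "s \<le> t" "t < 1"
  shows "quantile (cdf D) s \<le> quantile (cdf D) t"
  unfolding quantile_def
proof (rule cInf_superset_mono)
  interpret real_distribution D by fact
  have "\<forall>\<^sub>F x in at_top. t < cdf D x"
    using cdf_lim_at_top_prob assms by (intro order_tendstoD) auto
  then obtain x where "t < cdf D x" by (auto simp: eventually_at_top_linorder)
  then show "{x. t \<le> cdf D x} \<noteq> {}" by (auto intro: less_imp_le)
  have "\<forall>\<^sub>F x in at_bot. cdf D x < s"
    using cdf_lim_at_bot assms by (intro order_tendstoD) auto
  then obtain y where y: "\<And>x. x \<le> y \<Longrightarrow> cdf D x < s" by (auto simp: eventually_at_bot_linorder)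
  have "y \<le> x" if "s \<le> cdf D x" for x using y[of x] that by force
  then show "bdd_below {x. s \<le> cdf D x}" by (auto simp: bdd_below_def)
  show "{x. t \<le> cdf D x} \<subseteq> {x. s \<le> cdf D x}" using assms by auto
qed

text \<open>On the open unit interval the function is monotone. Elsewhere it takes at most three
  values: for \<open>s \<le> 0\<close> the defining set is the whole line, for \<open>s > 1\<close>
  it is empty, and \<open>s = 1\<close> is a single point.\<close>

lemma measurable_quantile:
  assumes "real_distribution D"
  shows "quantile (cdf D) \<in> borel_measurable borel"
proof -
  interpret real_distribution D by fact
  let ?Q = "quantile (cdf D)"
  have "mono_on {0<..<1} ?Q"
    by (rule mono_onI) (use quantile_mono[OF assms] in auto)
  then have m: "(\<lambda>x. indicator {0<..<1} x *\<^sub>R ?Q x) \<in> borel_measurable borel"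
    using borel_measurable_mono_on_fnc by (subst borel_measurable_restrict_space_iff[symmetric]) auto
  have low: "?Q s = ?Q 0" if "s \<le> 0" for s
  proof -
    have "{x. s \<le> cdf D x} = UNIV" using that cdf_nonneg order_trans by auto
    moreover have "{x. 0 \<le> cdf D x} = UNIV" using cdf_nonneg by auto
    ultimately show ?thesis by (simp add: quantile_def)
  qed
  have high: "?Q s = ?Q 2" if "s > 1" for s
  proof -
    have "{x. r \<le> cdf D x} = {}" if "r > 1" for r
      using that cdf_bounded_prob by (auto simp: not_le intro: le_less_trans)
    from this[OF that] this[of 2] show ?thesis by (simp add: quantile_def)
  qed
  define R where "R = ?Q"
  have "R s = (if s \<le> 0 then R 0 else if s = 1 then R 1 else if s > 1 then R 2
      else indicator {0<..<1} s *\<^sub>R R s)" for s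
    using low[of s] high[of s] unfolding R_def[symmetric] by (cases "s \<le> 0"; cases "s > 1") auto
  then have "R = (\<lambda>s. if s \<le> 0 then R 0 else if s = 1 then R 1 else if s > 1 then R 2
      else indicator {0<..<1} s *\<^sub>R R s)" by blast
  also have "\<dots> \<in> borel_measurable borel" using m unfolding R_def[symmetric] by measurable
  finally show ?thesis unfolding R_def .
qed

lemma has_bochner_integral_powr_uniform01:
  assumes "0 < c" "c < 1"
  shows "has_bochner_integral uniform01 (\<lambda>u. u powr (- c)) (1 / (1 - c))"
proof -
  have "((\<lambda>x. x powr (- c)) has_integral (1 / (1 - c))) {0..1}"
    using has_integral_powr_from_0[of "- c" 1] assms by simp
  from nn_integral_has_integral_lebesgue[OF _ this]
  have "(\<integral>\<^sup>+x. ennreal (indicator {0..1} x * x powr (- c)) \<partial>lborel) = ennreal (1 / (1 - c))" by simp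
  also have "(\<integral>\<^sup>+x. ennreal (indicator {0..1} x * x powr (- c)) \<partial>lborel)
      = (\<integral>\<^sup>+x. ennreal (indicator {0<..<1} x *\<^sub>R x powr (- c)) \<partial>lborel)"
  proof (rule nn_integral_cong_AE)
    show "AE x in lborel. ennreal (indicator {0..1} x * x powr (- c))
        = ennreal (indicator {0<..<1} x *\<^sub>R x powr (- c))"
      using AE_lborel_singleton[of 1] by (rule eventually_mono) (auto simp: indicator_def)
  qed
  finally have "has_bochner_integral lborel (\<lambda>x. indicator {0<..<1} x *\<^sub>R x powr (- c)) (1 / (1 - c))"
    using assms by (intro has_bochner_integral_nn_integral) auto
  then show ?thesis
    unfolding uniform01_eq_density by (intro has_bochner_integral_density) auto
qed

text \<open>The constant is the maximum of \<open>x powr q * exp (- c * x)\<close>, attained at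
  \<open>x = q / c\<close>; the proof is \<open>ln z \<le> z - 1\<close> at
  \<open>z = c * x / q\<close>. Its sharpness gives the right exponential order of high
  moments.\<close>

lemma powr_le_exp_mult:
  fixes x q c :: real
  assumes "0 \<le> x" "0 < q" "0 < c"
  shows "x powr q \<le> (q / (c * exp 1)) powr q * exp (c * x)"
proof (cases "x = 0")
  case False
  have "ln (c * x / q) \<le> c * x / q - 1" using assms False by (intro ln_le_minus_one) auto
  then have "q * ln (c * x / q) \<le> q * (c * x / q - 1)" using assms by (intro mult_left_mono) auto
  then have "q * ln x \<le> q * (ln q - (ln c + 1)) + c * x"
    using assms False by (simp add: ln_div ln_mult algebra_simps)
  moreover have "(q / (c * exp 1)) powr q = exp (q * (ln q - (ln c + 1)))"
    using assms by (simp add: powr_def ln_div ln_mult)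
  moreover have "x powr q = exp (q * ln x)" using assms False by (simp add: powr_def)
  ultimately show ?thesis by (simp flip: exp_add)
qed (use assms in simp)

text \<open>Since \<open>Q\<close> is monotone, Potter-type bounds follow from the slow variation condition for the
  single ratio \<open>1/2\<close> by iterating along a dyadic grid.\<close>

lemma dyadic_bounds:
  fixes G :: "real \<Rightarrow> real"
  assumes mono: "\<And>s t. 0 < s \<Longrightarrow> s \<le> t \<Longrightarrow> t < v0 \<Longrightarrow> G t \<le> G s"
    and half: "\<And>s. 0 < s \<Longrightarrow> s < v0 \<Longrightarrow> a * ln 2 \<le> G (s / 2) - G s \<and> G (s / 2) - G s \<le> b * ln 2"
    and ab: "0 < a" "0 < b" and v: "0 < v" "v < v0" and u: "0 < u" "u < 1"
  shows "a * (- ln u - ln 2) \<le> G (u * v) - G v" "G (u * v) - G v \<le> b * (- ln u + ln 2)"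
proof -
  have iter: "real m * (a * ln 2) \<le> G (v / 2 ^ m) - G v \<and> G (v / 2 ^ m) - G v \<le> real m * (b * ln 2)" for m
  proof (induction m)
    case (Suc m)
    have "v / 2 ^ m \<le> v" using v by (simp add: field_simps)
    then have "0 < v / 2 ^ m" "v / 2 ^ m < v0" using v by auto
    from half[OF this] Suc show ?case by (simp add: algebra_simps)
  qed simp
  \<comment> \<open>With this choice \<open>u\<close> lies between \<open>1 / 2 ^ Suc m\<close> and
    \<open>1 / 2 ^ m\<close>. Rounding to the dyadic grid costs at most one step, which is the
    additive \<open>ln 2\<close> in the bounds.\<close>
  define m where "m = nat \<lfloor>- ln u / ln 2\<rfloor>"
  have pos: "0 \<le> - ln u / ln 2" using u by (intro divide_nonneg_pos) auto
  have m1: "real m \<le> - ln u / ln 2" and m2: "- ln u / ln 2 < real m + 1"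
    using pos unfolding m_def by linarith+
  have "real m * ln 2 \<le> - ln u" using m1 by (simp add: field_simps)
  moreover have "ln (2 ^ m) = real m * ln (2::real)" by (rule ln_realpow)
  ultimately have "ln u \<le> ln (1 / 2 ^ m)" by (simp add: ln_div)
  then have u1: "u \<le> 1 / 2 ^ m" using u by (subst (asm) ln_le_cancel_iff) auto
  have "- ln u \<le> (real m + 1) * ln 2" using m2 by (simp add: field_simps)
  moreover have "ln (2 ^ Suc m) = real (Suc m) * ln (2::real)" by (rule ln_realpow)
  ultimately have "ln (1 / 2 ^ Suc m) \<le> ln u"
    by (simp add: ln_div algebra_simps del: power_Suc)
  then have u2: "1 / 2 ^ Suc m \<le> u" using u by (subst (asm) ln_le_cancel_iff) auto
  have uv: "0 < u * v" "u * v < v0"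
    using u v mult_strict_mono[of u 1 v v0] by auto
  have d1: "v / 2 ^ m < v0" "v / 2 ^ Suc m \<le> u * v" "u * v \<le> v / 2 ^ m"
  proof -
    have "v / 2 ^ m \<le> v" using v by (simp add: field_simps)
    then show "v / 2 ^ m < v0" using v by simp
    show "v / 2 ^ Suc m \<le> u * v" using mult_right_mono[OF u2, of v] v by simp
    show "u * v \<le> v / 2 ^ m" using mult_right_mono[OF u1, of v] v by simp
  qed
  have "a * (- ln u - ln 2) \<le> real m * (a * ln 2)"
  proof -
    have "- ln u - ln 2 \<le> real m * ln 2" using m2 by (simp add: field_simps)
    from mult_left_mono[OF this, of a] ab show ?thesis by (simp add: algebra_simps)
  qed
  also have "\<dots> \<le> G (v / 2 ^ m) - G v" using iter by blast
  also have "\<dots> \<le> G (u * v) - G v" using mono[OF uv(1) d1(3) d1(1)] by simp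
  finally show "a * (- ln u - ln 2) \<le> G (u * v) - G v" .
  have "G (u * v) - G v \<le> G (v / 2 ^ Suc m) - G v"
    using mono[OF _ d1(2) uv(2)] v by simp
  also have "\<dots> \<le> real (Suc m) * (b * ln 2)" using iter by blast
  also have "\<dots> \<le> b * (- ln u + ln 2)"
  proof -
    have "real (Suc m) * ln 2 \<le> - ln u + ln 2" using m1 by (simp add: field_simps)
    from mult_left_mono[OF this, of b] ab show ?thesis by (simp add: algebra_simps)
  qed
  finally show "G (u * v) - G v \<le> b * (- ln u + ln 2)" .
qed

section \<open>Potter bounds and moment estimates for Y(v)\<close>

locale regular_quantile =
  fixes D :: "real measure" and Q l :: "real \<Rightarrow> real" and \<gamma> :: real
  assumes D: "real_distribution D" and Q_quantile: "Q = quantile (cdf D)" and \<gamma>: "\<gamma> > 0"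
    and slow: "slowly_varying_at_0 l"
    and Q_eq: "\<And>s. 0 < s \<Longrightarrow> s < 1 \<Longrightarrow> Q (1 - s) = s powr (- \<gamma>) * l s"
begin

lemma measurable_Q [measurable]: "Q \<in> borel_measurable borel"
  unfolding Q_quantile by (rule measurable_quantile[OF D])

lemma Q_antimono: "0 < s \<Longrightarrow> s \<le> t \<Longrightarrow> t < 1 \<Longrightarrow> Q (1 - t) \<le> Q (1 - s)"
  unfolding Q_quantile by (rule quantile_mono[OF D]) auto

lemma measurable_Y [measurable]: "Y Q v \<in> borel_measurable borel"
  unfolding Y_def[abs_def] by measurable

lemma measurable_Y_mean [measurable]: "Y_mean Q p \<in> borel_measurable borel"
proof -
  interpret prob_space uniform01 by (rule prob_space_uniform01)
  have "(\<lambda>z. Y Q (fst z) (snd z) powr p) \<in> borel_measurable (borel \<Otimes>\<^sub>M uniform01)"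
    unfolding Y_def by measurable
  then show ?thesis
    unfolding Y_mean_def[abs_def] by (intro borel_measurable_lebesgue_integral) (simp add: case_prod_beta')
qed

lemma measurable_Y_sd [measurable]: "Y_sd Q p \<in> borel_measurable borel"
proof -
  interpret prob_space uniform01 by (rule prob_space_uniform01)
  have m: "Y_mean Q p \<in> borel_measurable borel" by measurable
  have "(\<lambda>z. (Y Q (fst z) (snd z) powr p - Y_mean Q p (fst z))\<^sup>2) \<in> borel_measurable (borel \<Otimes>\<^sub>M uniform01)"
    unfolding Y_def using m by measurable
  then have "(\<lambda>v. \<integral>u. (Y Q v u powr p - Y_mean Q p v)\<^sup>2 \<partial>uniform01) \<in> borel_measurable borel"
    by (intro borel_measurable_lebesgue_integral) (simp add: case_prod_beta')
  then show ?thesis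
    unfolding Y_sd_def[abs_def] Y_var_def Y_mean_def by measurable
qed

text \<open>With \<open>G s = ln (Q (1 - s))\<close>, the variable is
  \<open>G (u * v) - G v\<close>. Halving the argument changes \<open>G\<close> by
  \<open>\<gamma> * ln 2\<close> plus the logarithm of a ratio of \<open>l\<close> that tends to
  \<open>1\<close>, so near \<open>0\<close> each halving step lies between \<open>a * ln 2\<close>
  and \<open>b * ln 2\<close>. Here \<open>- ln u\<close> is a standard exponential
  variable.\<close>

lemma potter:
  assumes a: "0 < a" "a < \<gamma>" and b: "\<gamma> < b"
  obtains v0 where "0 < v0" "v0 < 1"
    "\<And>u v. 0 < v \<Longrightarrow> v < v0 \<Longrightarrow> 0 < u \<Longrightarrow> u < 1 \<Longrightarrow>
      0 \<le> Y Q v u \<and> a * (- ln u - ln 2) \<le> Y Q v u \<and> Y Q v u \<le> b * (- ln u + ln 2)"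
proof -
  have pos: "\<forall>\<^sub>F s in at_right 0. l s > 0" using slow by (simp add: slowly_varying_at_0_def)
  have "((\<lambda>s. l (1/2 * s) / l s) \<longlongrightarrow> 1) (at_right 0)"
    using slow unfolding slowly_varying_at_0_def by (metis half_gt_zero zero_less_one)
  then have "((\<lambda>s. ln (l (1/2 * s) / l s)) \<longlongrightarrow> ln 1) (at_right 0)"
    by (rule tendsto_ln) simp
  then have lim: "((\<lambda>s. \<gamma> * ln 2 + ln (l (1/2 * s) / l s)) \<longlongrightarrow> \<gamma> * ln 2 + 0) (at_right 0)"
    by (intro tendsto_add tendsto_const) simp
  have e1: "\<forall>\<^sub>F s in at_right 0. a * ln 2 < \<gamma> * ln 2 + ln (l (1/2 * s) / l s)"
    using lim a by (intro order_tendstoD) auto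
  have e2: "\<forall>\<^sub>F s in at_right 0. \<gamma> * ln 2 + ln (l (1/2 * s) / l s) < b * ln 2"
    using lim b by (intro order_tendstoD) auto
  from eventually_conj[OF pos eventually_conj[OF e1 e2]]
  obtain w where w: "0 < w" and W: "\<And>s. 0 < s \<Longrightarrow> s < w \<Longrightarrow> l s > 0 \<and>
      a * ln 2 < \<gamma> * ln 2 + ln (l (1/2 * s) / l s) \<and> \<gamma> * ln 2 + ln (l (1/2 * s) / l s) < b * ln 2"
    unfolding eventually_at_right_field by auto
  define v0 where "v0 = min w (1/2)"
  have v0: "0 < v0" "v0 < 1" "v0 \<le> w" using w by (auto simp: v0_def)
  define G where "G s = ln (Q (1 - s))" for s
  have Qpos: "0 < Q (1 - s)" if "0 < s" "s < v0" for s
    using W[of s] that v0 by (subst Q_eq) auto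
  have mono: "G t \<le> G s" if "0 < s" "s \<le> t" "t < v0" for s t
    unfolding G_def using that v0 Qpos[of s] Qpos[of t] Q_antimono[of s t]
    by (subst ln_le_cancel_iff) auto
  have half: "a * ln 2 \<le> G (s / 2) - G s \<and> G (s / 2) - G s \<le> b * ln 2" if s: "0 < s" "s < v0" for s
  proof -
    have l: "0 < l s" "0 < l (s / 2)" using W[of s] W[of "s/2"] s v0 by auto
    have "G (s / 2) - G s = \<gamma> * ln 2 + ln (l (1/2 * s) / l s)"
      unfolding G_def using s v0 l by (simp add: Q_eq ln_mult ln_div ln_powr algebra_simps)
    then show ?thesis using W[of s] s v0 by auto
  qed
  have Y: "Y Q v u = G (u * v) - G v" and uv: "0 < u * v" "u * v \<le> v"
    if "0 < v" "v < v0" "0 < u" "u < 1" for u v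
  proof -
    show uv: "0 < u * v" "u * v \<le> v" using that by (auto simp: mult_le_cancel_right1)
    show "Y Q v u = G (u * v) - G v"
      unfolding Y_def G_def using Qpos[of v] Qpos[of "u * v"] uv that by (subst ln_div) auto
  qed
  show thesis
  proof (rule that[of v0])
    fix u v :: real assume uv0: "0 < v" "v < v0" "0 < u" "u < 1"
    show "0 \<le> Y Q v u \<and> a * (- ln u - ln 2) \<le> Y Q v u \<and> Y Q v u \<le> b * (- ln u + ln 2)"
      unfolding Y[OF uv0]
      using dyadic_bounds[of v0 G a b v u, OF mono half] a b \<gamma> uv0 mono[OF uv[OF uv0]] by auto
  qed (use v0 in auto)
qed

definition gamma_scale :: "real \<Rightarrow> real" where
  "gamma_scale q = (\<gamma> * q / exp 1) powr q"

lemma gamma_scale_pos: "0 < q \<Longrightarrow> 0 < gamma_scale q"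
  unfolding gamma_scale_def using \<gamma> by simp

text \<open>The factor \<open>r powr (r * q)\<close> is the exponential growth of the moment ratio,
  against which the decay of \<open>real k powr (1 - r)\<close> is later weighed.\<close>

lemma gamma_scale_mult:
  assumes "0 < q" "0 < r"
  shows "gamma_scale (r * q) = r powr (r * q) * gamma_scale q powr r"
proof -
  have "gamma_scale (r * q) = (r * (\<gamma> * q / exp 1)) powr (r * q)"
    by (simp add: gamma_scale_def mult_ac)
  also have "\<dots> = r powr (r * q) * (\<gamma> * q / exp 1) powr (r * q)"
    using assms \<gamma> by (intro powr_mult)
  also have "(\<gamma> * q / exp 1) powr (r * q) = gamma_scale q powr r"
    by (simp add: gamma_scale_def powr_powr mult.commute)
  finally show ?thesis .
qed

text \<open>\<open>gamma_scale q\<close> is the size of the \<open>q\<close>-th moment of \<open>\<gamma>\<close> times a standard exponential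
  variable, up to subexponential factors; this precision is all that the moment ratios need.\<close>

lemma Y_mean_bounds:
  assumes \<theta>: "1 < \<theta>"
  obtains C v0 where "0 < C" "0 < v0" "v0 < 1"
    "\<And>v q. 0 < v \<Longrightarrow> v < v0 \<Longrightarrow> 0 < q \<Longrightarrow> integrable uniform01 (\<lambda>u. Y Q v u powr q)"
    "\<And>v q. 0 < v \<Longrightarrow> v < v0 \<Longrightarrow> 0 < q \<Longrightarrow> Y_mean Q q v \<le> C * \<theta> powr q * gamma_scale q"
    "\<And>v q. 0 < v \<Longrightarrow> v < v0 \<Longrightarrow> 0 < q \<Longrightarrow> gamma_scale q \<le> C * \<theta> powr q * Y_mean Q q v"
proof -
  interpret prob_space uniform01 by (rule prob_space_uniform01)
  \<comment> \<open>Being below \<open>1\<close>, \<open>c\<close> makes \<open>u powr (- c)\<close>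
    integrable. The loss \<open>1 / c = sqrt \<theta>\<close> and the loss
    \<open>sqrt \<theta>\<close> in the upper Potter slope multiply to exactly
    \<open>\<theta>\<close>.\<close>
  define c where "c = 1 / sqrt \<theta>"
  have c: "0 < c" "c < 1" using \<theta> by (auto simp: c_def)
  have h: "0 < \<gamma> / \<theta>" "\<gamma> / \<theta> < \<gamma>" "\<gamma> < \<gamma> * sqrt \<theta>"
    using \<gamma> \<theta> by (auto simp: field_simps)
  obtain v0 where v0: "0 < v0" "v0 < 1" and
    Yb: "\<And>u v. 0 < v \<Longrightarrow> v < v0 \<Longrightarrow> 0 < u \<Longrightarrow> u < 1 \<Longrightarrow>
      0 \<le> Y Q v u \<and> \<gamma> / \<theta> * (- ln u - ln 2) \<le> Y Q v u \<and> Y Q v u \<le> \<gamma> * sqrt \<theta> * (- ln u + ln 2)"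
    by (rule potter[OF h]) blast
  \<comment> \<open>\<open>K q\<close> is the constant of the majorant
    \<open>K q * u powr (- c)\<close>: the Potter slope, the maximum of a power against an
    exponential, and \<open>2 powr c\<close> from the shift by \<open>ln 2\<close>.\<close>
  define K where "K q = (\<gamma> * sqrt \<theta>) powr q * (q / (c * exp 1)) powr q * 2 powr c" for q
  have K: "K q = 2 powr c * (\<theta> powr q * gamma_scale q)" if "0 < q" for q
  proof -
    have "(\<gamma> * sqrt \<theta>) powr q * (q / (c * exp 1)) powr q = (\<gamma> * sqrt \<theta> * (q / (c * exp 1))) powr q"
      using \<gamma> \<theta> that c by (intro powr_mult[symmetric])
    also have "\<gamma> * sqrt \<theta> * (q / (c * exp 1)) = (sqrt \<theta> * sqrt \<theta>) * (\<gamma> * q / exp 1)"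
      unfolding c_def by (simp add: field_simps)
    also have "sqrt \<theta> * sqrt \<theta> = \<theta>" using \<theta> by simp
    also have "(\<theta> * (\<gamma> * q / exp 1)) powr q = \<theta> powr q * gamma_scale q"
      unfolding gamma_scale_def using \<theta> \<gamma> that by (intro powr_mult)
    finally show ?thesis by (simp add: K_def)
  qed
  have up: "Y Q v u powr q \<le> K q * u powr (- c)" if "0 < v" "v < v0" "0 < u" "u < 1" "0 < q" for u v q
  proof -
    have x: "0 \<le> - ln u + ln 2" using that by (simp add: add_nonneg_nonneg)
    have "Y Q v u powr q \<le> (\<gamma> * sqrt \<theta> * (- ln u + ln 2)) powr q"
      using Yb[OF that(1-4)] that by (intro powr_mono2) auto
    also have "\<dots> = (\<gamma> * sqrt \<theta>) powr q * (- ln u + ln 2) powr q"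
      using \<gamma> \<theta> x by (intro powr_mult)
    also have "\<dots> \<le> (\<gamma> * sqrt \<theta>) powr q * ((q / (c * exp 1)) powr q * exp (c * (- ln u + ln 2)))"
      using x that c by (intro mult_left_mono powr_le_exp_mult) auto
    also have "exp (c * (- ln u + ln 2)) = 2 powr c * u powr (- c)"
      using that by (simp add: powr_def algebra_simps flip: exp_add)
    finally show ?thesis by (simp add: K_def mult_ac)
  qed
  have hb: "has_bochner_integral uniform01 (\<lambda>u. K q * u powr (- c)) (K q * (1 / (1 - c)))" for q
    by (intro has_bochner_integral_mult_right has_bochner_integral_powr_uniform01 c)
  have up_AE: "AE u in uniform01. norm (Y Q v u powr q) \<le> K q * u powr (- c)"
    if "0 < v" "v < v0" "0 < q" for v q
    using AE_uniform01 by (rule eventually_mono) (use up that in auto)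
  have int: "integrable uniform01 (\<lambda>u. Y Q v u powr q)" if "0 < v" "v < v0" "0 < q" for v q
  proof (rule Bochner_Integration.integrable_bound)
    show "integrable uniform01 (\<lambda>u. K q * u powr (- c))"
      using hb by (simp add: has_bochner_integral_iff)
    show "AE u in uniform01. norm (Y Q v u powr q) \<le> norm (K q * u powr (- c))"
      using up_AE[OF that] by (rule eventually_mono) (auto intro: order_trans)
  qed measurable
  have upper: "Y_mean Q q v \<le> 2 powr c / (1 - c) * \<theta> powr q * gamma_scale q"
    if "0 < v" "v < v0" "0 < q" for v q
  proof -
    have "norm (Y_mean Q q v) \<le> integral\<^sup>L uniform01 (\<lambda>u. K q * u powr (- c))"
      unfolding Y_mean_def
      by (rule norm_integral_le_integral_AE[OF _ up_AE[OF that]])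
        (use hb in \<open>simp add: has_bochner_integral_iff\<close>)
    also have "\<dots> = K q * (1 / (1 - c))" using hb by (simp only: has_bochner_integral_iff)
    finally show ?thesis by (simp add: K[OF that(3)] mult_ac)
  qed
  have lower: "gamma_scale q \<le> 2 * \<theta> powr q * Y_mean Q q v"
    if v: "0 < v" "v < v0" and q: "0 < q" for v q
  proof -
    \<comment> \<open>For \<open>u < w\<close> the quantity \<open>- ln u - ln 2\<close> is at least
      \<open>q\<close>, so the integrand is at least
      \<open>(\<gamma> / \<theta> * q) powr q\<close>. The probability \<open>w\<close> of this
      event supplies the factor \<open>exp (- q)\<close> contained in
      \<open>gamma_scale q\<close>.\<close>
    define w where "w = exp (- q) / 2"
    have "exp (- q) < 1" using q by simp
    then have w: "0 < w" "w < 1" unfolding w_def by (auto simp del: exp_less_one_iff)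
    have lw: "ln w = - q - ln 2" unfolding w_def by (simp add: ln_div)
    have "(\<gamma> / \<theta> * q) powr q * w = (\<integral>u. (\<gamma> / \<theta> * q) powr q * indicator {..<w} u \<partial>uniform01)"
      using measure_uniform01_lessThan[OF w] by (simp add: Int_absorb2)
    also have "\<dots> \<le> Y_mean Q q v"
      unfolding Y_mean_def
    proof (rule integral_mono_AE')
      show "integrable uniform01 (\<lambda>u. Y Q v u powr q)" by (rule int[OF v q])
      show "AE u in uniform01. (\<gamma> / \<theta> * q) powr q * indicator {..<w} u \<le> Y Q v u powr q"
        using AE_uniform01
      proof (rule eventually_mono)
        fix u :: real assume u: "0 < u \<and> u < 1"
        show "(\<gamma> / \<theta> * q) powr q * indicator {..<w} u \<le> Y Q v u powr q"
        proof (cases "u < w")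
          case True
          then have "ln u \<le> ln w" using u by simp
          then have "q \<le> - ln u - ln 2" using lw by simp
          then have "\<gamma> / \<theta> * q \<le> \<gamma> / \<theta> * (- ln u - ln 2)" using \<gamma> \<theta> by (intro mult_left_mono) auto
          also have "\<dots> \<le> Y Q v u" using Yb[of v u] u v by blast
          finally show ?thesis using True \<gamma> \<theta> q by (auto intro!: powr_mono2)
        qed auto
      qed
    qed auto
    finally have "(\<gamma> / \<theta> * q) powr q * w \<le> Y_mean Q q v" .
    moreover have "gamma_scale q = 2 * \<theta> powr q * ((\<gamma> / \<theta> * q) powr q * w)"
    proof -
      have e: "exp (- q) = (1 / exp 1) powr q" by (simp add: powr_def ln_div)
      have "\<theta> powr q * ((\<gamma> / \<theta> * q) powr q * exp (- q)) = (\<theta> * (\<gamma> / \<theta> * q * (1 / exp 1))) powr q"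
        by (simp only: powr_mult e)
      also have "\<theta> * (\<gamma> / \<theta> * q * (1 / exp 1)) = \<gamma> * q / exp 1" using \<theta> by simp
      finally show ?thesis unfolding gamma_scale_def w_def by simp
    qed
    ultimately show ?thesis using \<theta> by (simp add: mult_left_mono)
  qed
  define C where "C = max 2 (2 powr c / (1 - c))"
  show thesis
  proof (rule that[of C v0])
    show "0 < C" by (simp add: C_def)
    show "integrable uniform01 (\<lambda>u. Y Q v u powr q)" if "0 < v" "v < v0" "0 < q" for v q
      by (rule int[OF that])
    show "Y_mean Q q v \<le> C * \<theta> powr q * gamma_scale q" if "0 < v" "v < v0" "0 < q" for v q
      using upper[OF that] gamma_scale_pos[OF that(3)]
        mult_right_mono[of "2 powr c / (1 - c)" C "\<theta> powr q * gamma_scale q"]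
      by (simp add: C_def mult.assoc)
    show "gamma_scale q \<le> C * \<theta> powr q * Y_mean Q q v" if "0 < v" "v < v0" "0 < q" for v q
    proof -
      have "0 \<le> Y_mean Q q v" unfolding Y_mean_def by simp
      then show ?thesis
        using lower[OF that] mult_right_mono[of 2 C "\<theta> powr q * Y_mean Q q v"]
        by (simp add: C_def mult.assoc)
    qed
  qed (use v0 in auto)
qed

end

section \<open>Moment ratios and the growth of k that dominates them\<close>

context regular_quantile
begin

text \<open>Both moments are compared with \<open>gamma_scale\<close>; the two comparisons cost
  \<open>\<theta> powr (r * q)\<close> each, hence the square of \<open>\<theta>\<close>. The first
  ratio controls Taylor remainders. The second, with \<open>r = 2\<close>, shows that the squared
  mean is small against the second moment. The constants do not depend on \<open>v\<close>,
  \<open>q\<close> or \<open>r\<close>.\<close>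

lemma Y_mean_ratio:
  assumes \<theta>: "1 < \<theta>"
  obtains C v0 where "0 < C" "0 < v0" "v0 < 1"
    "\<And>v q. 0 < v \<Longrightarrow> v < v0 \<Longrightarrow> 0 < q \<Longrightarrow> integrable uniform01 (\<lambda>u. Y Q v u powr q)"
    "\<And>v q. 0 < v \<Longrightarrow> v < v0 \<Longrightarrow> 0 < q \<Longrightarrow> 0 < Y_mean Q q v"
    "\<And>v q r. 0 < v \<Longrightarrow> v < v0 \<Longrightarrow> 0 < q \<Longrightarrow> 0 < r \<Longrightarrow>
      Y_mean Q (r * q) v \<le> C powr (1 + r) * (\<theta>\<^sup>2 * r) powr (r * q) * Y_mean Q q v powr r"
    "\<And>v q r. 0 < v \<Longrightarrow> v < v0 \<Longrightarrow> 0 < q \<Longrightarrow> 0 < r \<Longrightarrow>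
      Y_mean Q q v powr r \<le> C powr (1 + r) * (\<theta>\<^sup>2 / r) powr (r * q) * Y_mean Q (r * q) v"
proof -
  obtain C v0 where C: "0 < C" and v0: "0 < v0" "v0 < 1"
    and int: "\<And>v q. 0 < v \<Longrightarrow> v < v0 \<Longrightarrow> 0 < q \<Longrightarrow> integrable uniform01 (\<lambda>u. Y Q v u powr q)"
    and up: "\<And>v q. 0 < v \<Longrightarrow> v < v0 \<Longrightarrow> 0 < q \<Longrightarrow> Y_mean Q q v \<le> C * \<theta> powr q * gamma_scale q"
    and lo: "\<And>v q. 0 < v \<Longrightarrow> v < v0 \<Longrightarrow> 0 < q \<Longrightarrow> gamma_scale q \<le> C * \<theta> powr q * Y_mean Q q v"
    by (rule Y_mean_bounds[OF \<theta>]) blast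
  have pos: "0 < Y_mean Q q v" if "0 < v" "v < v0" "0 < q" for v q
  proof -
    have "0 < C * \<theta> powr q * Y_mean Q q v"
      using lo[OF that] gamma_scale_pos[OF that(3)] by linarith
    moreover have "0 < C * \<theta> powr q" using C \<theta> by simp
    ultimately show ?thesis by (simp only: zero_less_mult_pos)
  qed
  have \<theta>2: "(\<theta>\<^sup>2) powr x = \<theta> powr x * \<theta> powr x" for x
    by (simp add: power2_eq_square powr_mult)
  have C1: "C powr (1 + r) = C * C powr r" for r
    using C by (simp add: powr_add)
  show thesis
  proof (rule that[OF C v0 int pos])
    fix v q r :: real assume a: "0 < v" "v < v0" "0 < q" "0 < r"
    then have rq: "0 < r * q" by simp
    have "Y_mean Q (r * q) v \<le> C * \<theta> powr (r * q) * (r powr (r * q) * gamma_scale q powr r)"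
      using up[OF a(1,2) rq] unfolding gamma_scale_mult[OF a(3,4)] .
    also have "\<dots> \<le> C * \<theta> powr (r * q) * (r powr (r * q) * (C * \<theta> powr q * Y_mean Q q v) powr r)"
      using lo[OF a(1-3)] gamma_scale_pos[OF a(3)] a C by (intro mult_left_mono powr_mono2) auto
    also have "\<dots> = C powr (1 + r) * (\<theta>\<^sup>2 * r) powr (r * q) * Y_mean Q q v powr r"
      unfolding C1 powr_mult \<theta>2 powr_powr by (simp add: mult_ac)
    finally show "Y_mean Q (r * q) v \<le> C powr (1 + r) * (\<theta>\<^sup>2 * r) powr (r * q) * Y_mean Q q v powr r" .
    have "Y_mean Q q v powr r \<le> (C * \<theta> powr q * gamma_scale q) powr r"
      using up[OF a(1-3)] pos[OF a(1-3)] a by (intro powr_mono2) auto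
    also have "\<dots> = C powr r * \<theta> powr (r * q) * (gamma_scale (r * q) / r powr (r * q))"
      unfolding gamma_scale_mult[OF a(3,4)] using a by (simp add: powr_mult powr_powr mult_ac)
    also have "\<dots> \<le> C powr r * \<theta> powr (r * q) * (C * \<theta> powr (r * q) * Y_mean Q (r * q) v / r powr (r * q))"
      using lo[OF a(1,2) rq] by (intro mult_left_mono divide_right_mono) auto
    also have "\<dots> = C powr (1 + r) * (\<theta>\<^sup>2 / r) powr (r * q) * Y_mean Q (r * q) v"
      unfolding C1 using a by (simp add: powr_divide \<theta>2 mult_ac)
    finally show "Y_mean Q q v powr r \<le> C powr (1 + r) * (\<theta>\<^sup>2 / r) powr (r * q) * Y_mean Q (r * q) v" .
  qed
qed

end

text \<open>As \<open>r\<close> decreases to \<open>1\<close>, \<open>r ln r / (r - 1)\<close> tends to \<open>1\<close>: this is where the threshold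
  on \<open>\<alpha>\<close> comes from.\<close>

lemma exists_moment_order:
  fixes a :: real
  assumes a: "1 < a"
  obtains r \<theta> where "1 < r" "r \<le> 3/2" "1 < \<theta>" "\<theta>\<^sup>2 < 2" "r * ln (\<theta>\<^sup>2 * r) < (r - 1) * a"
proof -
  \<comment> \<open>\<open>r < a\<close> gives
    \<open>r * ln r \<le> r * (r - 1) < a * (r - 1)\<close>. The cap at \<open>3/2\<close> keeps
    \<open>2 * r\<close> within the admissible moment orders of the central limit estimate.\<close>
  define r where "r = min ((1 + a) / 2) (3/2)"
  have r: "1 < r" "r \<le> 3/2" "r < a" using a by (auto simp: r_def min_def)
  have "r * ln r \<le> r * (r - 1)" using r by (intro mult_left_mono ln_le_minus_one) auto
  also have "\<dots> < a * (r - 1)" using r by (intro mult_strict_right_mono) auto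
  finally have "0 < (r - 1) * a - r * ln r" by (simp add: mult.commute)
  then obtain d where d: "d = (r - 1) * a - r * ln r" "0 < d" by blast
  \<comment> \<open>\<open>\<kappa>\<close> will be the logarithm of the square of
    \<open>\<theta>\<close>. The first bound fits it into the slack \<open>d\<close>; the second
    keeps the square below \<open>2\<close>, so that the variance stays comparable with the second
    moment.\<close>
  define \<kappa> where "\<kappa> = min (d / (2 * r)) (ln 2 / 2)"
  have \<kappa>: "0 < \<kappa>" "r * \<kappa> < d" "\<kappa> < ln 2"
  proof -
    show "0 < \<kappa>" unfolding \<kappa>_def using r d by simp
    have "r * \<kappa> \<le> r * (d / (2 * r))"
      unfolding \<kappa>_def using r by (intro mult_left_mono) auto
    then show "r * \<kappa> < d" using r d by simp
    have "\<kappa> \<le> ln 2 / 2" unfolding \<kappa>_def by simp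
    moreover have "0 < ln (2::real)" by simp
    ultimately show "\<kappa> < ln 2" by linarith
  qed
  have sq: "(exp (\<kappa> / 2))\<^sup>2 = exp \<kappa>" by (simp flip: exp_of_nat_mult add: power2_eq_square exp_add[symmetric])
  show thesis
  proof (rule that[of r "exp (\<kappa> / 2)"])
    show "(exp (\<kappa> / 2))\<^sup>2 < 2" unfolding sq using \<kappa> by (metis exp_less_cancel_iff exp_ln zero_less_numeral)
    have "ln (exp \<kappa> * r) = \<kappa> + ln r" using r by (simp add: ln_mult)
    then show "r * ln ((exp (\<kappa> / 2))\<^sup>2 * r) < (r - 1) * a"
      unfolding sq using \<kappa> d by (simp add: algebra_simps)
  qed (use r \<kappa> in auto)
qed

text \<open>The logarithm of the product is \<open>(1 - r) * ln k + r * p * ln \<rho>\<close>.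
  Inserting \<open>ln k \<ge> a * p\<close> bounds it by a negative multiple of
  \<open>p\<close>.\<close>

lemma powr_rate_tendsto_0:
  fixes k :: "nat \<Rightarrow> nat" and p :: "nat \<Rightarrow> real"
  assumes r: "1 < r" and \<rho>: "0 < \<rho>" and rate: "r * ln \<rho> < (r - 1) * a"
    and p: "filterlim p at_top sequentially" and k: "filterlim k at_top sequentially"
    and kp: "\<forall>\<^sub>F n in sequentially. a * p n \<le> ln (real (k n))"
  shows "(\<lambda>n. real (k n) powr (1 - r) * \<rho> powr (r * p n)) \<longlonglongrightarrow> 0"
proof (rule tendsto_sandwich[OF _ _ tendsto_const])
  define \<kappa> where "\<kappa> = (r - 1) * a - r * ln \<rho>"
  have \<kappa>: "0 < \<kappa>" using rate by (simp add: \<kappa>_def)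
  show "\<forall>\<^sub>F n in sequentially. 0 \<le> real (k n) powr (1 - r) * \<rho> powr (r * p n)" by simp
  have "\<forall>\<^sub>F n in sequentially. 0 < k n" 
    using eventually_compose_filterlim[OF eventually_gt_at_top k] .
  with kp show "\<forall>\<^sub>F n in sequentially. real (k n) powr (1 - r) * \<rho> powr (r * p n) \<le> exp (- (\<kappa> * p n))"
  proof eventually_elim
    case (elim n)
    have "real (k n) powr (1 - r) * \<rho> powr (r * p n) = exp ((1 - r) * ln (real (k n)) + r * p n * ln \<rho>)"
      using elim \<rho> by (simp add: powr_def exp_add)
    also have "\<dots> \<le> exp (- (\<kappa> * p n))"
    proof -
      have "(r - 1) * (a * p n) \<le> (r - 1) * ln (real (k n))"
        using elim r by (intro mult_left_mono) auto
      then show ?thesis unfolding \<kappa>_def by (simp add: algebra_simps)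
    qed
    finally show ?case .
  qed
  have "filterlim (\<lambda>n. \<kappa> * p n) at_top sequentially"
    using \<kappa> p by (intro filterlim_tendsto_pos_mult_at_top[OF tendsto_const])
  then show "(\<lambda>n. exp (- (\<kappa> * p n))) \<longlonglongrightarrow> 0"
    by (intro filterlim_compose[OF exp_at_bot]) (simp add: filterlim_uminus_at_top[symmetric])
qed

section \<open>Characteristic function estimates uniform over small v\<close>

context regular_quantile
begin

text \<open>Divided by its mean, the power of \<open>Y\<close> has mean one, and its moment of order
  \<open>r\<close> is precisely the moment ratio. The bound on that ratio is uniform in
  \<open>v\<close>, so the error tends to zero uniformly.\<close>

lemma char_Y_lln:
  fixes k :: "nat \<Rightarrow> nat" and p :: "nat \<Rightarrow> real"
  assumes k: "filterlim k at_top sequentially" and p: "filterlim p at_top sequentially"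
    and a: "1 < a" and kp: "\<forall>\<^sub>F n in sequentially. a * p n \<le> ln (real (k n))"
    and \<delta>: "0 < \<delta>"
  shows "\<exists>v0>0. \<forall>\<^sub>F n in sequentially. \<forall>v. 0 < v \<and> v < v0 \<longrightarrow>
    cmod (char (distr uniform01 borel (\<lambda>u. Y Q v u powr p n / (real (k n) * Y_mean Q (p n) v))) t ^ k n
      - iexp t) \<le> \<delta>"
proof -
  interpret prob_space uniform01 by (rule prob_space_uniform01)
  obtain r \<theta> where r: "1 < r" "r \<le> 3/2" and \<theta>: "1 < \<theta>" and rate: "r * ln (\<theta>\<^sup>2 * r) < (r - 1) * a"
    by (rule exists_moment_order[OF a])
  obtain C v0 where C: "0 < C" and v0: "0 < v0" "v0 < 1"
    and int: "\<And>v q. 0 < v \<Longrightarrow> v < v0 \<Longrightarrow> 0 < q \<Longrightarrow> integrable uniform01 (\<lambda>u. Y Q v u powr q)"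
    and pos: "\<And>v q. 0 < v \<Longrightarrow> v < v0 \<Longrightarrow> 0 < q \<Longrightarrow> 0 < Y_mean Q q v"
    and ratio: "\<And>v q r. 0 < v \<Longrightarrow> v < v0 \<Longrightarrow> 0 < q \<Longrightarrow> 0 < r \<Longrightarrow>
      Y_mean Q (r * q) v \<le> C powr (1 + r) * (\<theta>\<^sup>2 * r) powr (r * q) * Y_mean Q q v powr r"
    by (rule Y_mean_ratio[OF \<theta>]) blast
  \<comment> \<open>The full error bound with the moment replaced by its estimate; it no longer
    involves \<open>v\<close>.\<close>
  define B where "B n = 2 * \<bar>t\<bar> powr r * (C powr (1 + r) * (real (k n) powr (1 - r) * (\<theta>\<^sup>2 * r) powr (r * p n)))
    + t\<^sup>2 / 2 * inverse (real (k n))" for n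
  have "(\<lambda>n. real (k n) powr (1 - r) * (\<theta>\<^sup>2 * r) powr (r * p n)) \<longlonglongrightarrow> 0"
    using r \<theta> by (intro powr_rate_tendsto_0[OF _ _ rate p k kp]) auto
  moreover have "(\<lambda>n. inverse (real (k n))) \<longlonglongrightarrow> 0"
    by (intro tendsto_inverse_0_at_top filterlim_compose[OF filterlim_real_sequentially k])
  ultimately have "B \<longlonglongrightarrow> 2 * \<bar>t\<bar> powr r * (C powr (1 + r) * 0) + t\<^sup>2 / 2 * 0"
    unfolding B_def by (intro tendsto_intros)
  then have "\<forall>\<^sub>F n in sequentially. B n < \<delta>" using \<delta> by (intro order_tendstoD) auto
  moreover have "\<forall>\<^sub>F n in sequentially. 0 < k n" 
    using eventually_compose_filterlim[OF eventually_gt_at_top k] .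
  moreover have "\<forall>\<^sub>F n in sequentially. 0 < p n" 
    using eventually_compose_filterlim[OF eventually_gt_at_top p] .
  ultimately have "\<forall>\<^sub>F n in sequentially. \<forall>v. 0 < v \<and> v < v0 \<longrightarrow>
    cmod (char (distr uniform01 borel (\<lambda>u. Y Q v u powr p n / (real (k n) * Y_mean Q (p n) v))) t ^ k n
      - iexp t) \<le> \<delta>"
  proof eventually_elim
    case (elim n)
    show ?case
    proof (intro allI impI)
      fix v assume "0 < v \<and> v < v0"
      then have v: "0 < v" "v < v0" by auto
      define m where "m = Y_mean Q (p n) v"
      define X where "X u = Y Q v u powr p n / m" for u
      have m: "0 < m" unfolding m_def by (rule pos[OF v elim(3)])
      have Xr: "\<bar>X u\<bar> powr r = Y Q v u powr (r * p n) / m powr r" for u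
        using m by (simp add: X_def powr_divide powr_powr mult.commute)
      have EXr: "expectation (\<lambda>u. \<bar>X u\<bar> powr r) = Y_mean Q (r * p n) v / m powr r"
        unfolding Xr by (simp add: Y_mean_def)
      have "expectation (\<lambda>u. \<bar>X u\<bar> powr r) \<le> C powr (1 + r) * (\<theta>\<^sup>2 * r) powr (r * p n)"
        using ratio[OF v elim(3), of r] m r unfolding EXr m_def[symmetric]
        by (simp add: divide_le_eq)
      then have le: "2 * \<bar>t\<bar> powr r * (real (k n) powr (1 - r) * expectation (\<lambda>u. \<bar>X u\<bar> powr r))
        \<le> 2 * \<bar>t\<bar> powr r * (real (k n) powr (1 - r) * (C powr (1 + r) * (\<theta>\<^sup>2 * r) powr (r * p n)))"
        by (intro mult_left_mono) auto
      have "cmod (char (distr uniform01 borel (\<lambda>u. X u / real (k n))) t ^ k n - iexp t)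
        \<le> 2 * \<bar>t\<bar> powr r * (real (k n) powr (1 - r) * expectation (\<lambda>u. \<bar>X u\<bar> powr r)) + t\<^sup>2 / (2 * real (k n))"
      proof (rule char_mean_bound)
        show "random_variable borel X" unfolding X_def[abs_def] by simp
        show "integrable uniform01 X" unfolding X_def[abs_def] using int[OF v elim(3)] by simp
        show "expectation X = 1" unfolding X_def[abs_def] using m by (simp add: m_def Y_mean_def)
        show "integrable uniform01 (\<lambda>u. \<bar>X u\<bar> powr r)"
          unfolding Xr using int[OF v, of "r * p n"] elim r by simp
      qed (use r elim in auto)
      also have "\<dots> \<le> B n" using le by (simp add: B_def mult_ac inverse_eq_divide)
      also have "(\<lambda>u. X u / real (k n)) = (\<lambda>u. Y Q v u powr p n / (real (k n) * Y_mean Q (p n) v))"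
        by (simp add: X_def m_def mult.commute)
      finally show "cmod (char (distr uniform01 borel
          (\<lambda>u. Y Q v u powr p n / (real (k n) * Y_mean Q (p n) v))) t ^ k n - iexp t) \<le> \<delta>"
        using elim(1) by linarith
    qed
  qed
  then show ?thesis using v0 by blast
qed

text \<open>The standardised power needs an absolute moment of order \<open>2 * s\<close>. Since the
  variance is eventually at least half the second moment, that moment is controlled by the ratio of
  order \<open>s\<close> for the doubled exponent.\<close>

lemma char_Y_clt:
  fixes k :: "nat \<Rightarrow> nat" and p :: "nat \<Rightarrow> real"
  assumes k: "filterlim k at_top sequentially" and p: "filterlim p at_top sequentially"
    and a: "2 < a" and kp: "\<forall>\<^sub>F n in sequentially. a * p n \<le> ln (real (k n))"
    and \<delta>: "0 < \<delta>"
  shows "\<exists>v0>0. \<forall>\<^sub>F n in sequentially. \<forall>v. 0 < v \<and> v < v0 \<longrightarrow>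
    cmod (char (distr uniform01 borel
        (\<lambda>u. (Y Q v u powr p n - Y_mean Q (p n) v) / (sqrt (real (k n)) * Y_sd Q (p n) v))) t ^ k n
      - exp (- (t\<^sup>2) / 2)) \<le> \<delta>"
proof -
  interpret prob_space uniform01 by (rule prob_space_uniform01)
  have a2: "1 < a / 2" using a by simp
  obtain s \<theta> where s: "1 < s" "s \<le> 3/2" and \<theta>: "1 < \<theta>" "\<theta>\<^sup>2 < 2"
    and rate: "s * ln (\<theta>\<^sup>2 * s) < (s - 1) * (a / 2)"
    by (rule exists_moment_order[OF a2])
  obtain C v0 where C: "0 < C" and v0: "0 < v0" "v0 < 1"
    and int: "\<And>v q. 0 < v \<Longrightarrow> v < v0 \<Longrightarrow> 0 < q \<Longrightarrow> integrable uniform01 (\<lambda>u. Y Q v u powr q)"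
    and pos: "\<And>v q. 0 < v \<Longrightarrow> v < v0 \<Longrightarrow> 0 < q \<Longrightarrow> 0 < Y_mean Q q v"
    and ratio: "\<And>v q r. 0 < v \<Longrightarrow> v < v0 \<Longrightarrow> 0 < q \<Longrightarrow> 0 < r \<Longrightarrow>
      Y_mean Q (r * q) v \<le> C powr (1 + r) * (\<theta>\<^sup>2 * r) powr (r * q) * Y_mean Q q v powr r"
    and ratio': "\<And>v q r. 0 < v \<Longrightarrow> v < v0 \<Longrightarrow> 0 < q \<Longrightarrow> 0 < r \<Longrightarrow>
      Y_mean Q q v powr r \<le> C powr (1 + r) * (\<theta>\<^sup>2 / r) powr (r * q) * Y_mean Q (r * q) v"
    by (rule Y_mean_ratio[OF \<theta>(1)]) blast
  \<comment> \<open>In terms of the doubled exponent the rate condition holds with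
    \<open>a / 2\<close> in place of \<open>a\<close>; it exceeds \<open>1\<close> because
    \<open>a > 2\<close>, which is the origin of the second threshold.\<close>
  define p2 where "p2 n = 2 * p n" for n
  have p2: "filterlim p2 at_top sequentially"
    unfolding p2_def by (intro filterlim_tendsto_pos_mult_at_top[OF tendsto_const _ p]) simp
  have kp2: "\<forall>\<^sub>F n in sequentially. a / 2 * p2 n \<le> ln (real (k n))"
    using kp by (simp add: p2_def)
  define B where "B n = \<bar>t\<bar> powr (2 * s) * (2 powr s * (C powr (1 + s) *
      (real (k n) powr (1 - s) * (\<theta>\<^sup>2 * s) powr (s * p2 n)) + real (k n) powr (1 - s)))
    + t ^ 4 / 8 * inverse (real (k n))" for n
  have kreal: "filterlim (\<lambda>n. real (k n)) at_top sequentially"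
    by (rule filterlim_compose[OF filterlim_real_sequentially k])
  have "(\<lambda>n. real (k n) powr (1 - s) * (\<theta>\<^sup>2 * s) powr (s * p2 n)) \<longlonglongrightarrow> 0"
    using s \<theta> by (intro powr_rate_tendsto_0[OF _ _ rate p2 k kp2]) auto
  moreover have "(\<lambda>n. inverse (real (k n))) \<longlonglongrightarrow> 0"
    by (intro tendsto_inverse_0_at_top kreal)
  moreover have "(\<lambda>n. real (k n) powr (1 - s)) \<longlonglongrightarrow> 0"
    using s by (intro tendsto_neg_powr kreal) auto
  ultimately have "B \<longlonglongrightarrow> \<bar>t\<bar> powr (2 * s) * (2 powr s * (C powr (1 + s) * 0 + 0)) + t ^ 4 / 8 * 0"
    unfolding B_def by (intro tendsto_intros)
  then have "\<forall>\<^sub>F n in sequentially. B n < \<delta>" using \<delta> by (intro order_tendstoD) auto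
  moreover have "\<forall>\<^sub>F n in sequentially. 0 < k n" 
    using eventually_compose_filterlim[OF eventually_gt_at_top k] .
  moreover have "\<forall>\<^sub>F n in sequentially. 0 < p n" 
    using eventually_compose_filterlim[OF eventually_gt_at_top p] .
  \<comment> \<open>Because the square of \<open>\<theta>\<close> is below \<open>2\<close>, the
    squared mean eventually falls below half the second moment, so \<open>Y_var\<close> is positive
    and of the order of the second moment.\<close>
  moreover have "\<forall>\<^sub>F n in sequentially. C powr (1 + 2) * (\<theta>\<^sup>2 / 2) powr (2 * p n) < 1 / 2"
  proof -
    have "((\<lambda>x. (\<theta>\<^sup>2 / 2) powr x) \<longlongrightarrow> 0) at_top"
    proof -
      have "ln (\<theta>\<^sup>2 / 2) < 0" using \<theta> by (intro ln_less_zero) auto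
      then have "filterlim (\<lambda>x. x * ln (\<theta>\<^sup>2 / 2)) at_bot at_top"
        by (intro filterlim_tendsto_neg_mult_at_bot[OF tendsto_const _ filterlim_ident, THEN filterlim_cong[THEN iffD1, rotated 3]])
           (auto simp: mult.commute)
      then show ?thesis using \<theta> by (simp add: powr_def filterlim_compose[OF exp_at_bot])
    qed
    from filterlim_compose[OF this p2]
    have "(\<lambda>n. C powr (1 + 2) * (\<theta>\<^sup>2 / 2) powr (2 * p n)) \<longlonglongrightarrow> C powr (1 + 2) * 0"
      unfolding p2_def by (intro tendsto_intros)
    then show ?thesis by (intro order_tendstoD) auto
  qed
  ultimately have "\<forall>\<^sub>F n in sequentially. \<forall>v. 0 < v \<and> v < v0 \<longrightarrow>
    cmod (char (distr uniform01 borel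
        (\<lambda>u. (Y Q v u powr p n - Y_mean Q (p n) v) / (sqrt (real (k n)) * Y_sd Q (p n) v))) t ^ k n
      - exp (- (t\<^sup>2) / 2)) \<le> \<delta>"
  proof eventually_elim
    case (elim n)
    show ?case
    proof (intro allI impI)
      fix v assume "0 < v \<and> v < v0"
      then have v: "0 < v" "v < v0" by auto
      have pn: "0 < p n" "0 < p2 n" using elim by (auto simp: p2_def)
      define m where "m = Y_mean Q (p n) v"
      define m2 where "m2 = Y_mean Q (p2 n) v"
      define \<sigma> where "\<sigma> = Y_sd Q (p n) v"
      define Z where "Z u = Y Q v u powr p n" for u
      define X where "X u = (Z u - m) / \<sigma>" for u
      have [measurable]: "Z \<in> borel_measurable borel" unfolding Z_def[abs_def] by simp
      have m: "0 < m" and m2: "0 < m2" unfolding m_def m2_def by (rule pos[OF v], rule pn)+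
      have Zint: "integrable uniform01 Z" unfolding Z_def[abs_def] by (rule int[OF v pn(1)])
      have Zm: "expectation Z = m" unfolding Z_def[abs_def] m_def Y_mean_def ..
      have Z0: "0 \<le> Z u" for u by (simp add: Z_def)
      have Zsq: "(Z u)\<^sup>2 = Y Q v u powr p2 n" for u
        by (simp add: Z_def p2_def power2_eq_square flip: powr_add)
      have Z2int: "integrable uniform01 (\<lambda>u. (Z u)\<^sup>2)" unfolding Zsq by (rule int[OF v pn(2)])
      have Z2m: "expectation (\<lambda>u. (Z u)\<^sup>2) = m2" unfolding Zsq m2_def Y_mean_def ..
      have "Y_var Q (p n) v = expectation (\<lambda>u. (Z u - m)\<^sup>2)"
        unfolding Y_var_def Z_def m_def Y_mean_def ..
      also have "\<dots> = m2 - m\<^sup>2"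
        using variance_eq[OF Zint Z2int] unfolding Zm Z2m .
      finally have var: "Y_var Q (p n) v = m2 - m\<^sup>2" .
      have "m powr 2 \<le> C powr (1 + 2) * (\<theta>\<^sup>2 / 2) powr (2 * p n) * m2"
        using ratio'[OF v pn(1), of 2] by (simp add: m_def m2_def p2_def)
      also have "\<dots> \<le> 1 / 2 * m2" using elim(4) m2 by (intro mult_right_mono) auto
      finally have mm2: "m\<^sup>2 \<le> m2 / 2" using m by simp
      have \<sigma>2: "\<sigma>\<^sup>2 = m2 - m\<^sup>2" and \<sigma>: "0 < \<sigma>"
        unfolding \<sigma>_def Y_sd_def var using mm2 m2 by auto
      have var1: "expectation (\<lambda>u. (Z u - m)\<^sup>2) = \<sigma>\<^sup>2"
        using variance_eq[OF Zint Z2int] unfolding Zm Z2m \<sigma>2 .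
      have \<sigma>s: "(m2 / 2) powr s \<le> \<sigma> powr (2 * s)"
      proof -
        have "(m2 / 2) powr s \<le> (\<sigma>\<^sup>2) powr s" using \<sigma>2 mm2 m2 s by (intro powr_mono2) auto
        also have "(\<sigma>\<^sup>2) powr s = \<sigma> powr (2 * s)"
          using \<sigma> by (simp add: powr_powr flip: powr_numeral)
        finally show ?thesis .
      qed
      have ms: "m powr (2 * s) \<le> m2 powr s"
      proof -
        have "m powr (2 * s) = (m\<^sup>2) powr s" using m by (simp add: powr_powr flip: powr_numeral)
        also have "\<dots> \<le> m2 powr s" using mm2 m2 s by (intro powr_mono2) auto
        finally show ?thesis .
      qed
      have Xs: "\<bar>X u\<bar> powr (2 * s) \<le> (Y Q v u powr (s * p2 n) + m powr (2 * s)) / \<sigma> powr (2 * s)" for u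
      proof -
        \<comment> \<open>Two nonnegative numbers differ by at most their maximum, which avoids an
          extra factor from the triangle inequality.\<close>
        have "\<bar>Z u - m\<bar> powr (2 * s) \<le> max (Z u) m powr (2 * s)"
          using Z0[of u] m s by (intro powr_mono2) auto
        also have "\<dots> \<le> Z u powr (2 * s) + m powr (2 * s)" by (auto simp: max_def)
        also have "Z u powr (2 * s) = Y Q v u powr (s * p2 n)"
          by (simp add: Z_def p2_def powr_powr mult_ac)
        finally show ?thesis
          using \<sigma> by (simp add: X_def powr_divide divide_right_mono)
      qed
      have bint: "integrable uniform01 (\<lambda>u. (Y Q v u powr (s * p2 n) + m powr (2 * s)) / \<sigma> powr (2 * s))"
        using int[OF v, of "s * p2 n"] pn s by auto
      have Xm: "random_variable borel X" unfolding X_def[abs_def] by simp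
      have EXs: "expectation (\<lambda>u. \<bar>X u\<bar> powr (2 * s)) \<le> 2 powr s * (C powr (1 + s) * (\<theta>\<^sup>2 * s) powr (s * p2 n) + 1)"
      proof -
        have "expectation (\<lambda>u. \<bar>X u\<bar> powr (2 * s))
          \<le> expectation (\<lambda>u. (Y Q v u powr (s * p2 n) + m powr (2 * s)) / \<sigma> powr (2 * s))"
          by (rule integral_mono_AE'[OF bint]) (use Xs in auto)
        also have "\<dots> = (Y_mean Q (s * p2 n) v + m powr (2 * s)) / \<sigma> powr (2 * s)"
          using int[OF v, of "s * p2 n"] pn s prob_space by (simp add: Y_mean_def)
        \<comment> \<open>Numerator and denominator are both expressed through
          \<open>m2 powr s\<close>, which then cancels, and the dependence on \<open>v\<close> goes
          with it.\<close>
        also have "\<dots> \<le> (C powr (1 + s) * (\<theta>\<^sup>2 * s) powr (s * p2 n) * m2 powr s + m2 powr s) / (m2 / 2) powr s"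
          using ratio[OF v pn(2), of s] ms \<sigma>s s m2 unfolding m2_def[symmetric]
          by (intro frac_le add_mono) auto
        also have "\<dots> = 2 powr s * (C powr (1 + s) * (\<theta>\<^sup>2 * s) powr (s * p2 n) + 1)"
          using m2 by (simp add: powr_divide field_simps)
        finally show ?thesis .
      qed
      have "cmod (char (distr uniform01 borel (\<lambda>u. X u / sqrt (real (k n)))) t ^ k n - exp (- (t\<^sup>2) / 2))
        \<le> \<bar>t\<bar> powr (2 * s) * (real (k n) powr (1 - 2 * s / 2) * expectation (\<lambda>u. \<bar>X u\<bar> powr (2 * s)))
          + t ^ 4 / (8 * real (k n))"
      proof (rule char_standardized_bound[OF Xm])
        show "integrable uniform01 X" unfolding X_def[abs_def] using Zint by simp
        show "expectation X = 0" unfolding X_def[abs_def] using Zint Zm prob_space by simp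
        have X2: "(X u)\<^sup>2 = (Z u - m)\<^sup>2 / \<sigma>\<^sup>2" for u by (simp add: X_def power_divide)
        have "integrable uniform01 (\<lambda>u. (Z u)\<^sup>2 + m\<^sup>2 - 2 * Z u * m)" using Zint Z2int by auto
        then have "integrable uniform01 (\<lambda>u. (Z u - m)\<^sup>2)" unfolding power2_diff .
        then show "integrable uniform01 (\<lambda>u. (X u)\<^sup>2)" unfolding X2 by simp
        show "expectation (\<lambda>u. (X u)\<^sup>2) = 1" unfolding X2 using var1 \<sigma> by simp
        show "integrable uniform01 (\<lambda>u. \<bar>X u\<bar> powr (2 * s))"
        proof (rule Bochner_Integration.integrable_bound[OF bint])
          show "(\<lambda>u. \<bar>X u\<bar> powr (2 * s)) \<in> borel_measurable uniform01" using Xm by measurable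
          show "AE u in uniform01. norm (\<bar>X u\<bar> powr (2 * s))
            \<le> norm ((Y Q v u powr (s * p2 n) + m powr (2 * s)) / \<sigma> powr (2 * s))"
            using Xs by (intro AE_I2) (auto intro: order_trans[OF _ abs_ge_self])
        qed
      qed (use s elim in auto)
      also have "\<dots> \<le> \<bar>t\<bar> powr (2 * s) * (real (k n) powr (1 - 2 * s / 2) *
          (2 powr s * (C powr (1 + s) * (\<theta>\<^sup>2 * s) powr (s * p2 n) + 1))) + t ^ 4 / (8 * real (k n))"
        using EXs by (intro add_right_mono mult_left_mono) auto
      also have "\<dots> = B n" by (simp add: B_def algebra_simps inverse_eq_divide)
      also have "(\<lambda>u. X u / sqrt (real (k n)))
        = (\<lambda>u. (Y Q v u powr p n - Y_mean Q (p n) v) / (sqrt (real (k n)) * Y_sd Q (p n) v))"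
        by (simp add: X_def Z_def m_def \<sigma>_def mult.commute)
      finally show "cmod (char (distr uniform01 borel
        (\<lambda>u. (Y Q v u powr p n - Y_mean Q (p n) v) / (sqrt (real (k n)) * Y_sd Q (p n) v))) t ^ k n
          - exp (- (t\<^sup>2) / 2)) \<le> \<delta>"
        using elim(1) by linarith
    qed
  qed
  then show ?thesis using v0 by blast
qed

end

section \<open>Both limits, from the uniform estimates and Levy's continuity theorem\<close>

theorem theorem4p4:
  fixes M :: "'a measure" and U :: "nat \<Rightarrow> 'a \<Rightarrow> real"
    and D :: "real measure" and Q l :: "real \<Rightarrow> real" and \<gamma> :: real
    and k :: "nat \<Rightarrow> nat" and p :: "nat \<Rightarrow> real" and \<alpha> :: ereal
  assumes "prob_space M"
    and "prob_space.indep_vars M (\<lambda>_. borel) U {1..}"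
    and "\<And>i. i \<ge> 1 \<Longrightarrow> distr M borel (U i) = uniform01"
    and "real_distribution D"
    and "Q = quantile (cdf D)"
    and "\<gamma> > 0"
    and "slowly_varying_at_0 l"
    and "\<And>s. 0 < s \<Longrightarrow> s < 1 \<Longrightarrow> Q (1 - s) = s powr (- \<gamma>) * l s"
    and "\<And>n. n \<ge> 1 \<Longrightarrow> 1 \<le> k n \<and> k n \<le> n"
    and "filterlim k at_top sequentially"
    and "(\<lambda>n. real (k n) / real n) \<longlonglongrightarrow> 0"
    and "\<And>n. n \<ge> 1 \<Longrightarrow> p n > 0"
    and "filterlim p at_top sequentially"
    and "\<alpha> = liminf (\<lambda>n. ereal (ln (real (k n)) / p n))"
  shows "(\<alpha> > 1 \<longrightarrow>
           conv_in_prob M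
             (\<lambda>n \<omega>. 1 / (real (k n) * Y_mean Q (p n) (order_stat U n (k n + 1) \<omega>)) *
               (\<Sum>i=1..k n.
                  ln (Q (1 - order_stat U n i \<omega>) / Q (1 - order_stat U n (k n + 1) \<omega>)) powr p n))
             1) \<and>
         (\<alpha> > 2 \<longrightarrow>
           conv_in_distr M
             (\<lambda>n \<omega>. 1 / (sqrt (real (k n)) * Y_sd Q (p n) (order_stat U n (k n + 1) \<omega>)) *
               (\<Sum>i=1..k n.
                  ln (Q (1 - order_stat U n i \<omega>) / Q (1 - order_stat U n (k n + 1) \<omega>)) powr p n
                  - Y_mean Q (p n) (order_stat U n (k n + 1) \<omega>)))
             std_normal_distribution)"
proof -
  interpret prob_space M by fact
  interpret regular_quantile D Q l \<gamma> 
    by (rule regular_quantile.intro) (fact assms)+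
  note iid = assms(2) assms(3)
  note k = \<open>filterlim k at_top sequentially\<close> and p = \<open>filterlim p at_top sequentially\<close>
  note kn = \<open>(\<lambda>n. real (k n) / real n) \<longlonglongrightarrow> 0\<close>
  have Um: "U j \<in> borel_measurable M" if "j \<in> {1..n}" for j n
    using iid(1) that unfolding indep_vars_def2 by auto
  have summ: "(\<lambda>\<omega>. \<Sum>i=1..k n. h n (order_stat U n i \<omega>) (order_stat U n (k n + 1) \<omega>)) \<in> borel_measurable M"
    if hm: "\<And>n. (\<lambda>z. h n (fst z) (snd z)) \<in> borel_measurable (borel \<Otimes>\<^sub>M borel)"
    for h :: "nat \<Rightarrow> real \<Rightarrow> real \<Rightarrow> real" and n
  proof (rule borel_measurable_sum)
    fix i
    have "(\<lambda>\<omega>. (order_stat U n i \<omega>, order_stat U n (k n + 1) \<omega>)) \<in> M \<rightarrow>\<^sub>M borel \<Otimes>\<^sub>M borel"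
      by (intro measurable_Pair measurable_order_stat Um)
    from measurable_compose[OF this hm[of n]]
    show "(\<lambda>\<omega>. h n (order_stat U n i \<omega>) (order_stat U n (k n + 1) \<omega>)) \<in> borel_measurable M" by simp
  qed
  have rate: "\<exists>a>c. \<forall>\<^sub>F n in sequentially. a * p n \<le> ln (real (k n))" if c: "ereal c < \<alpha>" for c
  proof -
    \<comment> \<open>A real number strictly between \<open>c\<close> and \<open>\<alpha>\<close>
      turns the condition on the lower limit into an eventual inequality with a constant still above
      \<open>c\<close>; \<open>\<alpha>\<close> may be infinite.\<close>
    obtain a where a: "ereal c < ereal a" "ereal a < \<alpha>" using ereal_dense2[OF c] by auto
    have "\<forall>\<^sub>F n in sequentially. ereal a < ereal (ln (real (k n)) / p n)"
      using a(2) unfolding assms(14) by (rule less_LiminfD)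
    then have "\<forall>\<^sub>F n in sequentially. a * p n \<le> ln (real (k n))"
      using eventually_ge_at_top[of 1]
      by eventually_elim (use assms(12) in \<open>auto simp: less_divide_eq intro: less_imp_le\<close>)
    then show ?thesis using a(1) by auto
  qed
  have "conv_in_prob M
       (\<lambda>n \<omega>. 1 / (real (k n) * Y_mean Q (p n) (order_stat U n (k n + 1) \<omega>)) *
         (\<Sum>i=1..k n.
            ln (Q (1 - order_stat U n i \<omega>) / Q (1 - order_stat U n (k n + 1) \<omega>)) powr p n))
       1" if \<alpha>: "\<alpha> > 1"
  proof -
    \<comment> \<open>The random normalisation is moved into each summand as a function of the
      second argument. At \<open>u * v\<close> and \<open>v\<close> the summand is then a normalised
      power of \<open>Y Q v u\<close>.\<close>
    define h where "h n u v = ln (Q (1 - u) / Q (1 - v)) powr p n / (real (k n) * Y_mean Q (p n) v)"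
      for n u v
    have hm: "(\<lambda>z. h n (fst z) (snd z)) \<in> borel_measurable (borel \<Otimes>\<^sub>M borel)" for n
      unfolding h_def by measurable
    have hY: "h n (u * v) v = Y Q v u powr p n / (real (k n) * Y_mean Q (p n) v)" for n u v
      unfolding h_def Y_def ..
    obtain a where a: "1 < a" "\<forall>\<^sub>F n in sequentially. a * p n \<le> ln (real (k n))"
      using rate[of 1] \<alpha> by (auto simp: one_ereal_def)
    have "(\<lambda>n. char (distr M borel (\<lambda>\<omega>. \<Sum>i=1..k n.
        h n (order_stat U n i \<omega>) (order_stat U n (k n + 1) \<omega>))) t) \<longlonglongrightarrow> iexp t" for t
      by (rule char_order_stat_sum_tendsto[OF iid hm kn])
        (use char_Y_lln[OF k p a] in \<open>auto simp: hY\<close>)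
    then have "conv_in_prob M (\<lambda>n \<omega>. \<Sum>i=1..k n.
        h n (order_stat U n i \<omega>) (order_stat U n (k n + 1) \<omega>)) 1"
      by (intro conv_in_prob_if_char_tendsto summ hm) simp
    then show ?thesis by (simp add: h_def sum_divide_distrib)
  qed
  moreover have "conv_in_distr M
       (\<lambda>n \<omega>. 1 / (sqrt (real (k n)) * Y_sd Q (p n) (order_stat U n (k n + 1) \<omega>)) *
         (\<Sum>i=1..k n.
            ln (Q (1 - order_stat U n i \<omega>) / Q (1 - order_stat U n (k n + 1) \<omega>)) powr p n
            - Y_mean Q (p n) (order_stat U n (k n + 1) \<omega>)))
       std_normal_distribution" if \<alpha>: "\<alpha> > 2"
  proof -
    define h where "h n u v = (ln (Q (1 - u) / Q (1 - v)) powr p n - Y_mean Q (p n) v)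
      / (sqrt (real (k n)) * Y_sd Q (p n) v)" for n u v
    have hm: "(\<lambda>z. h n (fst z) (snd z)) \<in> borel_measurable (borel \<Otimes>\<^sub>M borel)" for n
      unfolding h_def by measurable
    have hY: "h n (u * v) v = (Y Q v u powr p n - Y_mean Q (p n) v) / (sqrt (real (k n)) * Y_sd Q (p n) v)"
      for n u v
      unfolding h_def Y_def ..
    have "ereal 2 < \<alpha>" using \<alpha> by simp
    from rate[OF this] obtain a where a: "2 < a" "\<forall>\<^sub>F n in sequentially. a * p n \<le> ln (real (k n))"
      by blast
    let ?X = "\<lambda>n \<omega>. \<Sum>i=1..k n. h n (order_stat U n i \<omega>) (order_stat U n (k n + 1) \<omega>)"
    have "(\<lambda>n. char (distr M borel (?X n)) t) \<longlonglongrightarrow> complex_of_real (exp (- (t\<^sup>2) / 2))" for t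
      by (rule char_order_stat_sum_tendsto[OF iid hm kn])
        (use char_Y_clt[OF k p a] in \<open>auto simp: hY norm_exp_eq_Re simp flip: exp_of_real\<close>)
    then have "weak_conv_m (\<lambda>n. distr M borel (?X n)) std_normal_distribution"
      by (intro levy_continuity real_distribution_distr summ hm real_dist_normal_dist)
        (simp add: char_std_normal_distribution)
    then have "conv_in_distr M ?X std_normal_distribution"
      unfolding conv_in_distr_def using summ[of h] hm by simp
    then show ?thesis by (simp add: h_def sum_divide_distrib)
  qed
  ultimately show ?thesis by blast
qed

end
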